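(* Fix $\varepsilon>0$. With probability tending to $1$ as $n\to\infty$, a Latin square of order $n$ chosen uniformly at random has no maximal partial transversal of deficit exceeding $n^{2/3+\varepsilon}$.
   Context: A Latin square of order $n$ is an $n\times n$ array on $n$ symbols in which each symbol occurs once in each row and each column; its entries are the triples $(i,j,L_{ij})$. A line is the set of all entries in a given row, in a given column, or with a given symbol. A partial transversal of deficit $d$ is a set of $n-d$ entries in which every line is represented at most once; it is maximal if it is not contained in any larger partial transversal. *)

theory Defs
  imports "HOL-Probability.Probability"
begin

text \<open>Rows, columns and symbols are all indexed by \<open>{..<n}\<close>. Arrays are extensional functions
  (value \<open>undefined\<close> off the \<open>n \<times> n\<close> grid), so that distinct elements of \<open>latin_squares n\<close> are
  distinct Latin squares and the set is finite.\<close>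

type_synonym array = "nat \<times> nat \<Rightarrow> nat"
type_synonym entry = "nat \<times> nat \<times> nat"

definition latin_squares :: "nat \<Rightarrow> array set" where
  "latin_squares n =
     {L \<in> {..<n} \<times> {..<n} \<rightarrow>\<^sub>E {..<n}.
        (\<forall>i<n. \<forall>k<n. \<exists>!j. j < n \<and> L (i, j) = k) \<and>
        (\<forall>j<n. \<forall>k<n. \<exists>!i. i < n \<and> L (i, j) = k)}"

definition entries :: "nat \<Rightarrow> array \<Rightarrow> entry set" where
  "entries n L = {(i, j, L (i, j)) | i j. i < n \<and> j < n}"

definition row_line :: "nat \<Rightarrow> array \<Rightarrow> nat \<Rightarrow> entry set" where
  "row_line n L r = {(i, j, k) \<in> entries n L. i = r}"

definition column_line :: "nat \<Rightarrow> array \<Rightarrow> nat \<Rightarrow> entry set" where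
  "column_line n L c = {(i, j, k) \<in> entries n L. j = c}"

definition symbol_line :: "nat \<Rightarrow> array \<Rightarrow> nat \<Rightarrow> entry set" where
  "symbol_line n L s = {(i, j, k) \<in> entries n L. k = s}"

definition lines :: "nat \<Rightarrow> array \<Rightarrow> entry set set" where
  "lines n L = row_line n L ` {..<n} \<union> column_line n L ` {..<n} \<union> symbol_line n L ` {..<n}"

definition partial_transversal :: "nat \<Rightarrow> array \<Rightarrow> entry set \<Rightarrow> bool" where
  "partial_transversal n L T \<longleftrightarrow>
     T \<subseteq> entries n L \<and> (\<forall>l \<in> lines n L. card (T \<inter> l) \<le> 1)"

text \<open>The size condition \<open>card T = n - d\<close> is stated additively: with truncated subtraction the
  empty set would have every \<open>d \<ge> n\<close> as a deficit.\<close>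

definition has_deficit :: "nat \<Rightarrow> entry set \<Rightarrow> nat \<Rightarrow> bool" where
  "has_deficit n T d \<longleftrightarrow> card T + d = n"

definition maximal_partial_transversal :: "nat \<Rightarrow> array \<Rightarrow> entry set \<Rightarrow> bool" where
  "maximal_partial_transversal n L T \<longleftrightarrow>
     partial_transversal n L T \<and> (\<nexists>T'. partial_transversal n L T' \<and> T \<subset> T')"

text \<open>\<open>pmf_of_set\<close> is only meaningful on a finite nonempty set.\<close>

lemma finite_latin_squares: "finite (latin_squares n)"
  unfolding latin_squares_def by (rule finite_subset[of _ "{..<n} \<times> {..<n} \<rightarrow>\<^sub>E {..<n}"])
    (auto intro: finite_PiE)

lemma ex1_add_mod_eq:
  assumes "i < n" "k < n"
  shows "\<exists>!j. j < n \<and> (i + j) mod n = (k::nat)"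
proof (rule ex1I)
  let ?j = "(k + (n - i)) mod n"
  have "(i + ?j) mod n = (k + n) mod n"
    using assms by (simp add: mod_add_right_eq)
  then show "?j < n \<and> (i + ?j) mod n = k" using assms by simp
next
  fix j assume j: "j < n \<and> (i + j) mod n = k"
  then have "(k + (n - i)) mod n = (i + j + (n - i)) mod n"
    using mod_add_left_eq[of "i + j" n "n - i"] by simp
  also have "\<dots> = j" using assms j by simp
  finally show "j = (k + (n - i)) mod n" by simp
qed

lemma latin_squares_nonempty: "latin_squares n \<noteq> {}"
proof -
  define L where "L = restrict (\<lambda>(i, j). (i + j) mod n) ({..<n} \<times> {..<n})"
  have L: "L (i, j) = (i + j) mod n" if "i < n" "j < n" for i j
    using that by (simp add: L_def)
  have "\<exists>!j. j < n \<and> L (i, j) = k" if "i < n" "k < n" for i k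
    using ex1_add_mod_eq[OF that] that by (simp add: L cong: conj_cong)
  moreover have "\<exists>!i. i < n \<and> L (i, j) = k" if "j < n" "k < n" for j k
    using ex1_add_mod_eq[OF that] that by (simp add: L add.commute cong: conj_cong)
  moreover have "L \<in> {..<n} \<times> {..<n} \<rightarrow>\<^sub>E {..<n}"
    by (rule PiE_I) (auto simp: L_def)
  ultimately have "L \<in> latin_squares n"
    by (simp add: latin_squares_def)
  then show ?thesis by blast
qed

definition random_latin_square :: "nat \<Rightarrow> array pmf" where
  "random_latin_square n = pmf_of_set (latin_squares n)"

end

theory Submission
  imports Defs
    "HOL-Computational_Algebra.Fundamental_Theorem_Algebra"
    "HOL-Real_Asymp.Real_Asymp"
begin

text \<open>If \<open>T\<close> is a maximal partial transversal of deficit at least \<open>d\<close>, there are sets \<open>A\<close>, \<open>B\<close>, \<open>C\<close> of \<open>d\<close>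
  rows, columns and symbols not met by \<open>T\<close>, and maximality means that no cell of \<open>A \<times> B\<close> holds a symbol
  of \<open>C\<close>. Build Latin squares one row at a time, starting with the rows of \<open>A\<close>; each new row is a perfect
  matching of the bipartite graph joining columns to the symbols still available in them. Bregman's
  bound limits the number of choices, and the columns of \<open>B\<close> have \<open>d\<close> fewer available symbols as long as
  rows of \<open>A\<close> are filled, which saves a factor \<open>exp (- ln 2 * d\<^sup>3 / n)\<close>. Without restriction the
  available graph is regular and van der Waerden's bound gives a lower estimate for the number of all Latin
  squares. The two bounds for the unrestricted count differ only by a factor \<open>exp (n (1 + ln n)\<^sup>2)\<close>, so the
  saving survives this loss and the union bound over at most \<open>8 ^ n\<close> triples \<open>(A, B, C)\<close> once
  \<open>d \<ge> n powr (2/3 + \<epsilon>)\<close>.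

  Van der Waerden's bound is proved by Gurvits' capacity argument, Bregman's by Schrijver's.\<close>

section \<open>Van der Waerden's bound for permanents\<close>

text \<open>Differentiating \<open>\<Prod>i\<in>I. b i\<close> in the directions \<open>ws\<close> gives \<open>mixed_form I ws b\<close>; for
  \<open>length ws = card I\<close> it is the permanent with columns \<open>ws\<close>.\<close>

primrec mixed_form :: "'i set \<Rightarrow> ('i \<Rightarrow> 'a::comm_semiring_1) list \<Rightarrow> ('i \<Rightarrow> 'a) \<Rightarrow> 'a" where
  "mixed_form I [] b = (\<Prod>i\<in>I. b i)"
| "mixed_form I (w # ws) b = (\<Sum>i\<in>I. w i * mixed_form (I - {i}) ws b)"

text \<open>The laws of a homomorphism are hypotheses, so that one proof covers both the embedding
  of the reals into the complex numbers and the evaluation of polynomials.\<close>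

lemma mixed_form_hom:
  assumes "h 0 = 0" "h 1 = 1" "\<And>x y. h (x + y) = h x + h y" "\<And>x y. h (x * y) = h x * h y"
  shows "h (mixed_form I ws b) = mixed_form I (map (\<lambda>w i. h (w i)) ws) (\<lambda>i. h (b i))"
proof (induction ws arbitrary: I)
  case Nil
  show ?case by (induction I rule: infinite_finite_induct) (auto simp: assms)
next
  case (Cons w ws)
  have "h (sum g A) = (\<Sum>i\<in>A. h (g i))" for g and A :: "'c set"
    by (induction A rule: infinite_finite_induct) (auto simp: assms)
  then show ?case by (simp add: assms Cons.IH)
qed

lemma mixed_form_pos:
  fixes b :: "'i \<Rightarrow> 'a::linordered_semidom"
  assumes "finite I" "length ws \<le> card I" "\<And>w i. w \<in> set ws \<Longrightarrow> i \<in> I \<Longrightarrow> w i > 0"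
    and "\<And>i. i \<in> I \<Longrightarrow> b i > 0"
  shows "mixed_form I ws b > 0"
  using assms
proof (induction ws arbitrary: I)
  case Nil
  then show ?case by (auto intro: prod_pos)
next
  case (Cons w ws)
  then have "I \<noteq> {}" by auto
  then show ?case using Cons by (auto intro!: sum_pos mult_pos_pos Cons.IH simp: card_Diff_singleton)
qed

text \<open>Each direction consumes one of the \<open>card I\<close> linear factors, so the form is
  homogeneous in \<open>b\<close> of the degree that is left.\<close>

lemma mixed_form_scale:
  assumes "finite I" "length ws \<le> card I"
  shows "mixed_form I ws (\<lambda>i. c * b i) = c ^ (card I - length ws) * mixed_form I ws b"
  using assms
proof (induction ws arbitrary: I)
  case Nil
  then show ?case by (simp add: prod.distrib)
next
  case (Cons w ws)
  have "mixed_form (I - {i}) ws (\<lambda>i. c * b i) = c ^ (card I - Suc (length ws)) * mixed_form (I - {i}) ws b"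
    if "i \<in> I" for i using Cons that by (auto simp: card_Diff_singleton)
  then show ?case by (simp add: sum_distrib_left mult.left_commute)
qed

lemma mixed_form_scale_list:
  "mixed_form I (map (\<lambda>w i. c * w i) ws) b = c ^ length ws * mixed_form I ws b"
  by (induction ws arbitrary: I) (auto simp: sum_distrib_left mult_ac)

lemma tendsto_mixed_form:
  fixes b :: "'i \<Rightarrow> 'a::real_normed_field"
  assumes "\<And>w i. w \<in> set ws \<Longrightarrow> ((\<lambda>t. W t w i) \<longlongrightarrow> V w i) F"
  shows "((\<lambda>t. mixed_form I (map (W t) ws) b) \<longlongrightarrow> mixed_form I (map V ws) b) F"
  using assms by (induction ws arbitrary: I) (auto intro!: tendsto_intros)

section \<open>Mixed forms along a line\<close>

text \<open>The same recursion is run over the polynomial ring, with constant directions and the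
  moving point \<open>b + t v\<close>; this makes degree, coefficients, \<open>pderiv\<close> and
  roots available.\<close>

definition line_poly :: "'i set \<Rightarrow> ('i \<Rightarrow> 'a::idom) list \<Rightarrow> ('i \<Rightarrow> 'a) \<Rightarrow> ('i \<Rightarrow> 'a) \<Rightarrow> 'a poly" where
  "line_poly I ws b v = mixed_form I (map (\<lambda>w i. [:w i:]) ws) (\<lambda>i. [:b i, v i:])"

lemma poly_line_poly: "poly (line_poly I ws b v) t = mixed_form I ws (\<lambda>i. b i + t * v i)"
  unfolding line_poly_def by (subst mixed_form_hom[where h = "\<lambda>p. poly p t"]) (auto simp: comp_def)

lemma line_poly_Nil: "line_poly I [] b v = (\<Prod>i\<in>I. [:b i, v i:])"
  by (simp add: line_poly_def)

lemma line_poly_Cons: "line_poly I (w # ws) b v = (\<Sum>i\<in>I. smult (w i) (line_poly (I - {i}) ws b v))"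
  by (simp add: line_poly_def)

text \<open>By the product rule, differentiating in \<open>t\<close> adds \<open>v\<close> as a
  further direction. It lands at the end of the list because the recursion peels directions off the
  front; later inductions therefore grow their lists at the end.\<close>

lemma pderiv_line_poly:
  assumes "finite I"
  shows "pderiv (line_poly I ws b v) = line_poly I (ws @ [v]) b v"
  using assms
proof (induction ws arbitrary: I)
  case Nil
  have "pderiv (\<Prod>i\<in>I. [:b i, v i:]) = (\<Sum>i\<in>I. smult (v i) (\<Prod>j\<in>I - {i}. [:b j, v j:]))"
    by (simp add: pderiv_prod pderiv_pCons)
  then show ?case by (simp add: line_poly_Nil line_poly_Cons)
next
  case (Cons w ws)
  have "pderiv (line_poly I (w # ws) b v) = (\<Sum>i\<in>I. pderiv (smult (w i) (line_poly (I - {i}) ws b v)))"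
    unfolding line_poly_Cons using higher_pderiv_sum[of 1] by simp
  with Cons show ?case by (simp add: line_poly_Cons pderiv_smult)
qed

text \<open>The top power of \<open>t\<close> picks \<open>v i\<close> from every linear factor that
  survives the directions. For positive data this coefficient is positive, which fixes the
  degree.\<close>

lemma line_poly_top_coeff:
  assumes "finite I" "length ws \<le> card I"
  shows "degree (line_poly I ws b v) \<le> card I - length ws \<and>
    coeff (line_poly I ws b v) (card I - length ws) = mixed_form I ws v"
  using assms
proof (induction ws arbitrary: I)
  case Nil
  from Nil(1) show ?case
  proof (induction I)
    case (insert i I)
    let ?p = "\<Prod>i\<in>I. [:b i, v i:]"
    have "degree ?p \<le> card I" "coeff ?p (card I) = (\<Prod>i\<in>I. v i)"
      using insert.IH by (auto simp: line_poly_Nil)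
    moreover have "degree ([:b i, v i:] * ?p) \<le> degree [:b i, v i:] + degree ?p"
      by (rule degree_mult_le)
    moreover have "degree [:b i, v i:] \<le> 1" by simp
    ultimately show ?case using insert
      by (auto simp: line_poly_Nil coeff_eq_0 simp del: mult_pCons_left mult_pCons_right degree_pCons_eq_if)
         (auto simp: coeff_eq_0)
  qed (auto simp: line_poly_Nil)
next
  case (Cons w ws)
  have *: "degree (line_poly (I - {i}) ws b v) \<le> card I - Suc (length ws)"
    "coeff (line_poly (I - {i}) ws b v) (card I - Suc (length ws)) = mixed_form (I - {i}) ws v"
    if "i \<in> I" for i
    using Cons.IH[of "I - {i}"] Cons.prems that by (auto simp: card_Diff_singleton)
  then show ?case
    by (auto simp: line_poly_Cons coeff_sum intro!: degree_sum_le order.trans[OF degree_smult_le] Cons.prems)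
qed

section \<open>Location of the roots\<close>

text \<open>Splitting off a root \<open>z\<close> adds \<open>1 / (- z)\<close> to the logarithmic
  derivative at \<open>0\<close>, and its real part is positive for \<open>Re z < 0\<close>. The
  weak inequality, which also holds for constants, is all that the induction hypothesis has to
  supply.\<close>

lemma pderiv_0_ratio_left_half_plane:
  fixes f :: "complex poly"
  assumes "f \<noteq> 0" "\<And>z. poly f z = 0 \<Longrightarrow> Re z < 0"
  shows "Re (poly (pderiv f) 0 / poly f 0) \<ge> 0 \<and> (degree f > 0 \<longrightarrow> Re (poly (pderiv f) 0 / poly f 0) > 0)"
  using assms
proof (induction "degree f" arbitrary: f)
  case 0
  then show ?case by (metis degree_0_id div_0 less_irrefl order_refl pderiv_0 pderiv_pCons poly_0 zero_complex.sel(1) add_0 degree_eq_zeroE pCons_0_0)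
next
  case (Suc n)
  then have "\<not> constant (poly f)" by (simp add: constant_degree)
  then obtain z where z: "poly f z = 0" using fundamental_theorem_of_algebra by blast
  then obtain g where g: "f = [:-z, 1:] * g" using poly_eq_0_iff_dvd by (metis dvdE)
  have "g \<noteq> 0" using g Suc.prems by auto
  then have "degree f = Suc (degree g)" unfolding g by (subst degree_mult_eq) auto
  moreover have zneg: "Re z < 0" using Suc.prems(2) z by auto
  moreover have "Re y < 0" if "poly g y = 0" for y using Suc.prems(2)[of y] that g by simp
  ultimately have IH: "Re (poly (pderiv g) 0 / poly g 0) \<ge> 0"
    using Suc.hyps \<open>g \<noteq> 0\<close> by auto
  have "poly g 0 \<noteq> 0" using Suc.prems(2)[of 0] g by auto
  then have "poly (pderiv f) 0 / poly f 0 = 1 / (-z) + poly (pderiv g) 0 / poly g 0"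
    using zneg unfolding g pderiv_mult by (auto simp: pderiv_pCons divide_simps)
  moreover have "Re (1 / (-z)) > 0"
  proof -
    have "Im z * Im z + Re z * Re z > 0" using zneg by (intro add_nonneg_pos mult_neg_neg) auto
    then show ?thesis using zneg
      by (simp add: Re_divide power2_eq_square divide_neg_pos add.commute)
  qed
  ultimately show ?case using IH by simp
qed

text \<open>In the step, all roots of \<open>t \<mapsto> mixed_form I ws (b + t w)\<close> lie in the left half-plane, so each term of
  its logarithmic derivative at \<open>0\<close>, the sum of \<open>- 1 / z\<close> over the roots \<open>z\<close>, has positive real part.\<close>

lemma mixed_form_nonzero:
  fixes b :: "'i \<Rightarrow> complex"
  assumes "finite I" "length ws \<le> card I" "\<And>w i. w \<in> set ws \<Longrightarrow> i \<in> I \<Longrightarrow> w i > 0"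
    and "\<And>i. i \<in> I \<Longrightarrow> Re (b i) > 0"
  shows "mixed_form I (map (\<lambda>w i. complex_of_real (w i)) ws) b \<noteq> 0"
  using assms(2-)
proof (induction ws arbitrary: b rule: rev_induct)
  case Nil
  then show ?case using assms(1) by fastforce
next
  case (snoc w ws)
  let ?ws = "map (\<lambda>w i. complex_of_real (w i)) ws"
  let ?w = "\<lambda>i. complex_of_real (w i)"
  let ?f = "line_poly I ?ws b ?w"
  have w: "w i > 0" if "i \<in> I" for i using snoc.prems that by simp
  \<comment> \<open>The induction generalises the point: moving it by \<open>t * w\<close> with
    \<open>Re t\<close> nonnegative keeps its coordinates in the right half-plane.\<close>
  have "poly ?f t \<noteq> 0" if "Re t \<ge> 0" for t
    unfolding poly_line_poly
    by (rule snoc.IH) (use snoc.prems w that in \<open>auto intro!: add_pos_nonneg mult_nonneg_nonneg simp: less_imp_le\<close>)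
  then have roots: "Re t < 0" if "poly ?f t = 0" for t using that by (meson not_le)
  have "coeff ?f (card I - length ws) = mixed_form I ?ws ?w"
    using line_poly_top_coeff[OF assms(1), of ?ws b ?w] snoc.prems(1) by simp
  also have "\<dots> = complex_of_real (mixed_form I ws w)"
    by (subst mixed_form_hom[where h = complex_of_real]) auto
  finally have "coeff ?f (card I - length ws) \<noteq> 0"
    using mixed_form_pos[of I ws w] assms(1) snoc.prems w by fastforce
  then have "degree ?f \<ge> card I - length ws" by (simp add: le_degree)
  then have "degree ?f > 0" using snoc.prems(1) by simp
  then have "poly (pderiv ?f) 0 \<noteq> 0"
    using pderiv_0_ratio_left_half_plane[of ?f] roots by fastforce
  then show ?case by (simp add: pderiv_line_poly[OF assms(1)] poly_line_poly)
qed

text \<open>The factors are normalised to constant term 1, with \<open>r = - 1 / z\<close> for a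
  root \<open>z\<close>. The sum of \<open>rs\<close> is then the logarithmic derivative at
  \<open>0\<close>; together with the degree it is all that the later bound retains of the
  roots.\<close>

lemma complex_poly_neg_real_roots_factor:
  fixes f :: "complex poly"
  assumes "f \<noteq> 0" "\<And>z. poly f z = 0 \<Longrightarrow> z \<in> \<real> \<and> Re z < 0"
  shows "\<exists>rs :: real list. length rs = degree f \<and> (\<forall>r\<in>set rs. r > 0) \<and>
           f = smult (poly f 0) (\<Prod>r\<leftarrow>rs. [:1, of_real r:])"
  using assms
proof (induction "degree f" arbitrary: f)
  case 0
  then have "f = [:poly f 0:]" by (metis degree_eq_zeroE poly_const_conv)
  with 0 show ?case by (intro exI[of _ "[]"]) simp
next
  case (Suc n)
  then have "\<not> constant (poly f)" by (simp add: constant_degree)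
  then obtain z where z: "poly f z = 0" using fundamental_theorem_of_algebra by blast
  then obtain x where x: "z = complex_of_real x" "x < 0"
    using Suc.prems(2)[OF z] by (metis Re_complex_of_real Reals_cases)
  obtain g where g: "f = [:-z, 1:] * g" using z poly_eq_0_iff_dvd by (metis dvdE)
  have "g \<noteq> 0" using g Suc.prems by auto
  have deg: "degree f = Suc (degree g)" unfolding g using \<open>g \<noteq> 0\<close> by (subst degree_mult_eq) auto
  have "y \<in> \<real> \<and> Re y < 0" if "poly g y = 0" for y using Suc.prems(2)[of y] that g by simp
  then obtain rs where rs: "length rs = degree g" "\<forall>r\<in>set rs. r > 0"
      "g = smult (poly g 0) (\<Prod>r\<leftarrow>rs. [:1, complex_of_real r:])"
    using Suc.hyps(1)[of g] Suc.hyps(2) deg \<open>g \<noteq> 0\<close> by auto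
  have z': "[:-z, 1:] = smult (-z) [:1, complex_of_real (-1/x):]"
    using x by (simp add: field_simps)
  have "f = smult (-z * poly g 0) ([:1, complex_of_real (-1/x):] * (\<Prod>r\<leftarrow>rs. [:1, complex_of_real r:]))"
    by (subst g, subst z', subst rs(3)) (simp only: mult_smult_left mult_smult_right smult_smult mult.commute[of "poly g 0"])
  moreover have "poly f 0 = -z * poly g 0" unfolding g by simp
  ultimately show ?case
    using rs(1,2) x deg by (intro exI[of _ "-1/x # rs"]) auto
qed

text \<open>Multiply the bounds \<open>x / \<mu> <= exp (x / \<mu> - 1)\<close>; for the mean
  \<open>\<mu>\<close> the exponents add up to zero.\<close>

lemma prod_list_le_mean_power:
  fixes xs :: "real list"
  assumes "\<And>x. x \<in> set xs \<Longrightarrow> x > 0"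
  shows "prod_list xs \<le> (sum_list xs / real (length xs)) ^ length xs"
proof (cases "xs = []")
  case False
  define \<mu> where "\<mu> = sum_list xs / real (length xs)"
  have "sum_list xs > 0" using assms False
    by (induction xs) (auto intro!: add_pos_nonneg sum_list_nonneg simp: less_imp_le)
  then have \<mu>: "\<mu> > 0" using False by (simp add: \<mu>_def)
  \<comment> \<open>Here \<open>\<mu>\<close> stays the mean of \<open>xs\<close> while
    \<open>ys\<close> varies, since the mean would change in an induction on
    \<open>xs\<close>.\<close>
  have "prod_list ys \<le> \<mu> ^ length ys * exp (sum_list ys / \<mu> - real (length ys))"
    if "\<And>x. x \<in> set ys \<Longrightarrow> x > 0" for ys
    using that
  proof (induction ys)
    case (Cons y ys)
    have "y / \<mu> \<le> exp (y / \<mu> - 1)" using exp_ge_add_one_self[of "y / \<mu> - 1"] by simp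
    then have "y \<le> \<mu> * exp (y / \<mu> - 1)" using \<mu> by (simp add: field_simps)
    then have "y * prod_list ys \<le> (\<mu> * exp (y / \<mu> - 1)) * (\<mu> ^ length ys * exp (sum_list ys / \<mu> - real (length ys)))"
      using Cons \<mu> by (intro mult_mono mult_nonneg_nonneg) (auto simp: less_imp_le prod_list_nonneg)
    also have "exp (y / \<mu> - 1) * exp (sum_list ys / \<mu> - real (length ys)) = exp ((y + sum_list ys) / \<mu> - real (Suc (length ys)))"
      by (subst exp_add[symmetric]) (simp add: add_divide_distrib algebra_simps)
    then have "(\<mu> * exp (y / \<mu> - 1)) * (\<mu> ^ length ys * exp (sum_list ys / \<mu> - real (length ys)))
        = \<mu> ^ Suc (length ys) * exp ((y + sum_list ys) / \<mu> - real (Suc (length ys)))"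
      by (metis (no_types, opaque_lifting) mult.assoc mult.left_commute power_Suc)
    finally show ?case by simp
  qed simp
  from this[of xs] assms have "prod_list xs \<le> \<mu> ^ length xs * exp (sum_list xs / \<mu> - real (length xs))" by blast
  moreover have "sum_list xs / \<mu> = real (length xs)"
    using \<mu> False by (simp add: \<mu>_def field_simps)
  ultimately show ?thesis by (simp add: \<mu>_def)
qed simp

text \<open>The polynomial \<open>t \<mapsto> mixed_form I ws (b + t v)\<close> has only negative real roots: for any other root \<open>z\<close>
  multiply by the conjugate \<open>l\<close> of \<open>csqrt z\<close>, so that \<open>l * (b + z v)\<close> lies in the right half-plane, and use
  homogeneity. The bound is then the inequality of arithmetic and geometric means.\<close>

lemma mixed_form_line_bound:
  fixes b v :: "'i \<Rightarrow> real"
  assumes fin: "finite I" and len: "length ws < card I"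
    and ws: "\<And>w i. w \<in> set ws \<Longrightarrow> i \<in> I \<Longrightarrow> w i > 0"
    and b: "\<And>i. i \<in> I \<Longrightarrow> b i > 0" and v: "\<And>i. i \<in> I \<Longrightarrow> v i > 0" and "t \<ge> 0"
  defines "m \<equiv> card I - length ws"
  shows "mixed_form I ws (\<lambda>i. b i + t * v i)
     \<le> mixed_form I ws b * (1 + t * (mixed_form I (ws @ [v]) b / mixed_form I ws b) / real m) ^ m"
proof -
  let ?c = "\<lambda>w i. complex_of_real (w i)"
  let ?f = "line_poly I (map ?c ws) (?c b) (?c v)"
  have pos: "mixed_form I ws b > 0" "mixed_form I ws v > 0"
    using mixed_form_pos[of I ws] fin len ws b v by auto
  have of_real_mixed: "complex_of_real (mixed_form I us x) = mixed_form I (map ?c us) (?c x)" for us x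
    by (rule mixed_form_hom) auto
  have f_real: "poly ?f (of_real t) = of_real (mixed_form I ws (\<lambda>i. b i + t * v i))" for t
    by (simp add: poly_line_poly of_real_mixed)
  have coeff: "coeff ?f m = of_real (mixed_form I ws v)" "degree ?f \<le> m"
    using line_poly_top_coeff[OF fin, of "map ?c ws" "?c b" "?c v"] len by (auto simp: m_def of_real_mixed)
  then have "coeff ?f m \<noteq> 0" using pos by simp
  then have deg: "degree ?f = m" using coeff(2) le_degree by (metis le_antisym)
  have "?f \<noteq> 0" using \<open>coeff ?f m \<noteq> 0\<close> by auto
  have roots: "z \<in> \<real> \<and> Re z < 0" if z: "poly ?f z = 0" for z
  proof (rule ccontr)
    assume neg: "\<not> (z \<in> \<real> \<and> Re z < 0)"
    have "z \<noteq> 0" using z f_real[of 0] pos by auto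
    \<comment> \<open>The principal root has nonnegative real part, which vanishes only for a
      nonpositive real \<open>z\<close>; but \<open>z\<close> is neither zero nor a negative
      real.\<close>
    have "Re (csqrt z) > 0"
    proof (rule ccontr)
      assume "\<not> Re (csqrt z) > 0"
      then have "Re (csqrt z) = 0" using Re_csqrt[of z] by linarith
      then have "csqrt z = \<i> * of_real (Im (csqrt z))" by (simp add: complex_eq_iff)
      then have "z = (\<i> * of_real (Im (csqrt z)))\<^sup>2" by (metis power2_csqrt)
      then have eq: "z = - of_real ((Im (csqrt z))\<^sup>2)" by (simp add: power_mult_distrib)
      then have "z \<in> \<real>" "Re z \<le> 0" by (metis Reals_minus Reals_of_real) (subst eq, simp)
      moreover have "Re z \<noteq> 0" using \<open>z \<noteq> 0\<close> \<open>z \<in> \<real>\<close> by (auto simp: complex_eq_iff complex_is_Real_iff)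
      ultimately show False using neg by auto
    qed
    define l where "l = cnj (csqrt z)"
    have l: "Re l > 0" using \<open>Re (csqrt z) > 0\<close> by (simp add: l_def)
    define r where "r = (cmod (csqrt z))\<^sup>2"
    \<comment> \<open>As \<open>l * csqrt z\<close> is the squared modulus of
      \<open>csqrt z\<close>, the product \<open>l * z\<close> is a nonnegative multiple of
      \<open>csqrt z\<close>.\<close>
    have "l * z = complex_of_real r * csqrt z" unfolding r_def
      by (metis complex_norm_square l_def mult.commute mult.assoc power2_csqrt power2_eq_square)
    moreover have "r \<ge> 0" by (simp add: r_def)
    moreover have "Re (complex_of_real r * w) = r * Re w" for w by simp
    ultimately have lz: "Re (l * z) \<ge> 0" using \<open>Re (csqrt z) > 0\<close>
      by (metis less_imp_le mult_nonneg_nonneg)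
    have "mixed_form I (map ?c ws) (\<lambda>i. l * (of_real (b i) + z * of_real (v i))) \<noteq> 0"
    proof (rule mixed_form_nonzero[OF fin])
      fix i assume "i \<in> I"
      have "Re (l * (of_real (b i) + z * of_real (v i))) = Re l * b i + Re (l * z) * v i"
        by (simp add: algebra_simps)
      then show "Re (l * (of_real (b i) + z * of_real (v i))) > 0"
        using l lz b[OF \<open>i \<in> I\<close>] v[OF \<open>i \<in> I\<close>] by (simp add: add_pos_nonneg)
    qed (use len ws in auto)
    then show False using z fin len by (simp add: mixed_form_scale poly_line_poly)
  qed
  obtain rs where rs: "length rs = m" "\<forall>r\<in>set rs. r > 0"
      "?f = smult (poly ?f 0) (\<Prod>r\<leftarrow>rs. [:1, complex_of_real r:])"
    using complex_poly_neg_real_roots_factor[OF \<open>?f \<noteq> 0\<close> roots] deg by blast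
  have f0: "poly ?f 0 = of_real (mixed_form I ws b)" using f_real[of 0] by simp
  have prod_eval: "poly (\<Prod>r\<leftarrow>qs. [:1, complex_of_real r:]) (of_real t) = of_real (\<Prod>r\<leftarrow>qs. 1 + t * r)" for t qs
    by (induction qs) (auto simp: algebra_simps)
  have val: "mixed_form I ws (\<lambda>i. b i + t * v i) = mixed_form I ws b * (\<Prod>r\<leftarrow>rs. 1 + t * r)"
  proof -
    have "complex_of_real (mixed_form I ws (\<lambda>i. b i + t * v i)) = of_real (mixed_form I ws b * (\<Prod>r\<leftarrow>rs. 1 + t * r))"
      using arg_cong[OF rs(3), of "\<lambda>p. poly p (of_real t)"]
      unfolding f_real f0 poly_smult prod_eval of_real_mult .
    then show ?thesis by (simp only: of_real_eq_iff)
  qed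
  \<comment> \<open>The derivative at \<open>0\<close> of a product of factors
    \<open>1 + r t\<close> is the sum of the \<open>r\<close>. So the ratio of the two mixed forms
    is \<open>sum_list rs\<close>, which determines the mean used below.\<close>
  have deriv: "poly (pderiv (\<Prod>r\<leftarrow>qs. [:1, complex_of_real r:])) 0 = of_real (sum_list qs)" for qs
  proof (induction qs)
    case (Cons q qs)
    have "poly (\<Prod>r\<leftarrow>qs. [:1, complex_of_real r:]) 0 = 1" using prod_eval[of qs 0] by (simp add: map_replicate_const)
    with Cons show ?case by (simp add: pderiv_mult pderiv_pCons del: mult_pCons_left)
  qed simp
  have "of_real (mixed_form I (ws @ [v]) b) = poly (pderiv ?f) 0"
    by (simp add: pderiv_line_poly[OF fin] poly_line_poly of_real_mixed)
  also have "\<dots> = of_real (mixed_form I ws b * sum_list rs)"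
    using arg_cong[OF rs(3), of "\<lambda>p. poly (pderiv p) 0"]
    unfolding pderiv_smult poly_smult f0 deriv of_real_mult .
  finally have "mixed_form I (ws @ [v]) b = mixed_form I ws b * sum_list rs" by (simp only: of_real_eq_iff)
  then have s: "mixed_form I (ws @ [v]) b / mixed_form I ws b = sum_list rs" using pos by simp
  have m: "m > 0" using len by (simp add: m_def)
  have "(\<Prod>r\<leftarrow>rs. 1 + t * r) \<le> (sum_list (map (\<lambda>r. 1 + t * r) rs) / real m) ^ m"
  proof -
    have "x > 0" if "x \<in> set (map (\<lambda>r. 1 + t * r) rs)" for x
      using that rs(2) \<open>t \<ge> 0\<close> by (auto intro!: add_pos_nonneg simp: less_imp_le)
    then show ?thesis using prod_list_le_mean_power[of "map (\<lambda>r. 1 + t * r) rs"] rs(1) by simp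
  qed
  also have "sum_list (map (\<lambda>r. 1 + t * r) rs) = real m + t * sum_list rs"
    using rs(1) by (simp add: sum_list_addf sum_list_const_mult sum_list_triv)
  also have "(real m + t * sum_list rs) / real m = 1 + t * sum_list rs / real m"
    using m by (simp add: add_divide_distrib)
  finally show ?thesis unfolding val s using pos by (intro mult_left_mono) auto
qed

section \<open>Gurvits' capacity inequality\<close>

text \<open>The value is 1 at \<open>k = n\<close> and \<open>fact n / real n ^ n\<close> at
  \<open>k = 0\<close>, where \<open>0 ^ 0 = 1\<close>. Going from \<open>k + 1\<close> down to
  \<open>k\<close> costs the factor \<open>(k / (k + 1)) ^ k\<close> lost in one
  differentiation.\<close>

definition gurvits_const :: "nat \<Rightarrow> nat \<Rightarrow> real" where
  "gurvits_const n k = fact n / real n ^ n * (real k ^ k / fact k)"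

text \<open>Concavity of \<open>ln\<close> bounds each row's weighted mean below by a weighted
  geometric mean. In the product over the rows the exponents of \<open>x j\<close> add up to the
  column sum 1, so the capacity is at least 1.\<close>

lemma doubly_stochastic_product_ge:
  fixes a :: "'i \<Rightarrow> 'j \<Rightarrow> real"
  assumes "finite I" "finite J" and a: "\<And>i j. i \<in> I \<Longrightarrow> j \<in> J \<Longrightarrow> a i j > 0"
    and rows: "\<And>i. i \<in> I \<Longrightarrow> (\<Sum>j\<in>J. a i j) = 1"
    and cols: "\<And>j. j \<in> J \<Longrightarrow> (\<Sum>i\<in>I. a i j) = 1"
    and x: "\<And>j. j \<in> J \<Longrightarrow> x j > 0"
  shows "(\<Prod>j\<in>J. x j) \<le> (\<Prod>i\<in>I. \<Sum>j\<in>J. a i j * x j)"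
proof -
  have le: "exp (\<Sum>j\<in>J. a i j * ln (x j)) \<le> (\<Sum>j\<in>J. a i j * x j)" if "i \<in> I" for i
  proof -
    define s where "s = (\<Sum>j\<in>J. a i j * x j)"
    have "J \<noteq> {}" using rows[OF that] by auto
    then have s: "s > 0" unfolding s_def using assms that by (intro sum_pos) auto
    have "(\<Sum>j\<in>J. a i j * ln (x j)) \<le> (\<Sum>j\<in>J. a i j * (ln s + (x j / s - 1)))"
    proof (intro sum_mono mult_left_mono)
      fix j assume "j \<in> J"
      then have "ln (x j / s) \<le> x j / s - 1" using x s by (intro ln_le_minus_one) auto
      then show "ln (x j) \<le> ln s + (x j / s - 1)" using x[OF \<open>j \<in> J\<close>] s by (simp add: ln_div)
    qed (use a that in \<open>auto simp: less_imp_le\<close>)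
    also have "\<dots> = (\<Sum>j\<in>J. a i j * (ln s - 1) + a i j * x j / s)"
      by (simp add: algebra_simps)
    also have "\<dots> = (\<Sum>j\<in>J. a i j) * (ln s - 1) + (\<Sum>j\<in>J. a i j * x j) / s"
      by (simp only: sum.distrib sum_distrib_right sum_divide_distrib)
    also have "\<dots> = ln s" using s rows[OF that] by (simp add: s_def[symmetric])
    finally show ?thesis using s by (metis exp_le_cancel_iff exp_ln s_def)
  qed
  have "(\<Prod>j\<in>J. x j) = exp (\<Sum>j\<in>J. ln (x j))"
    using x by (simp add: exp_sum[OF \<open>finite J\<close>])
  also have "(\<Sum>j\<in>J. ln (x j)) = (\<Sum>j\<in>J. (\<Sum>i\<in>I. a i j) * ln (x j))" using cols by simp
  also have "\<dots> = (\<Sum>i\<in>I. \<Sum>j\<in>J. a i j * ln (x j))"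
    by (simp add: sum_distrib_right) (rule sum.swap)
  also have "exp \<dots> = (\<Prod>i\<in>I. exp (\<Sum>j\<in>J. a i j * ln (x j)))" by (simp add: exp_sum[OF \<open>finite I\<close>])
  also have "\<dots> \<le> (\<Prod>i\<in>I. \<Sum>j\<in>J. a i j * x j)" using le by (intro prod_mono) auto
  finally show ?thesis .
qed

text \<open>In the step the point \<open>t\<close> minimises the bound of \<open>mixed_form_line_bound\<close> divided by \<open>t\<close>.\<close>

lemma capacity_bound:
  fixes a :: "'i \<Rightarrow> 'j \<Rightarrow> real"
  assumes fin: "finite I" "finite J" and card: "card I = n" "card J = n"
    and a: "\<And>i j. i \<in> I \<Longrightarrow> j \<in> J \<Longrightarrow> a i j > 0"
    and rows: "\<And>i. i \<in> I \<Longrightarrow> (\<Sum>j\<in>J. a i j) = 1"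
    and cols: "\<And>j. j \<in> J \<Longrightarrow> (\<Sum>i\<in>I. a i j) = 1"
    and cs: "distinct cs" "set cs \<subseteq> J" and x: "\<And>j. j \<in> J \<Longrightarrow> x j > 0"
  shows "gurvits_const n (n - length cs) * (\<Prod>j\<in>J - set cs. x j)
     \<le> mixed_form I (map (\<lambda>j i. a i j) cs) (\<lambda>i. \<Sum>j\<in>J - set cs. a i j * x j)"
  using cs x
proof (induction cs arbitrary: x rule: rev_induct)
  case Nil
  have "gurvits_const n n = 1" by (cases "n = 0") (auto simp: gurvits_const_def)
  then show ?case using doubly_stochastic_product_ge[OF fin a rows cols Nil(3)] by simp
next
  case (snoc c cs)
  define K where "K = J - set (cs @ [c])"
  define k where "k = n - length (cs @ [c])"
  let ?ws = "map (\<lambda>j i. a i j) cs"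
  have K: "J - set cs = insert c K" "c \<notin> K" "finite K" using snoc.prems fin by (auto simp: K_def)
  have "card K = n - length (cs @ [c])" unfolding K_def
    using snoc.prems fin card by (subst card_Diff_subset) (auto simp: distinct_card[symmetric])
  then have cardK: "card K = k" by (simp add: k_def)
  have "length (cs @ [c]) \<le> n" using snoc.prems card fin by (metis card_mono distinct_card)
  then have len: "n - length cs = Suc k" "length cs < n" by (auto simp: k_def)
  define X where "X = (\<Prod>j\<in>K. x j)"
  have X: "X > 0" unfolding X_def using snoc.prems by (intro prod_pos) (auto simp: K_def)
  define b where "b = (\<lambda>i. \<Sum>j\<in>K. a i j * x j)"
  \<comment> \<open>The coordinate of the new column is freed as \<open>t\<close>, so the induction
    hypothesis bounds the mixed form along the line through \<open>b\<close> in the direction of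
    that column.\<close>
  have IH: "gurvits_const n (Suc k) * (t * X) \<le> mixed_form I ?ws (\<lambda>i. b i + t * a i c)" if "t > 0" for t
  proof -
    have *: "(\<Prod>j\<in>K. (x(c := t)) j) = X" "(\<Sum>j\<in>K. a i j * (x(c := t)) j) = b i" for i
      unfolding X_def b_def using K by (auto intro!: prod.cong sum.cong)
    show ?thesis using snoc.IH[of "x(c := t)"] snoc.prems that K * len
      by (simp add: add.commute mult.commute[of t])
  qed
  have apos: "w i > 0" if "w \<in> set ?ws" "i \<in> I" for w i
    using that snoc.prems a by auto
  have avpos: "a i c > 0" if "i \<in> I" for i using that snoc.prems a by auto
  let ?M' = "mixed_form I (?ws @ [\<lambda>i. a i c]) b"
  have "gurvits_const n k * X \<le> ?M'"
  \<comment> \<open>For \<open>k = 0\<close> no column is left, so \<open>b\<close> is zero and the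
    positivity behind the line bound fails. The polynomial is then linear without constant term, and
    its value at 1 is its derivative.\<close>
  proof (cases "k = 0")
    case True
    then have "K = {}" using cardK K by simp
    then have b0: "b = (\<lambda>i. 0)" by (simp add: b_def)
    let ?f = "line_poly I ?ws b (\<lambda>i. a i c)"
    have "mixed_form I ?ws (\<lambda>i. b i + 1 * a i c) = ?M'"
    proof -
      have deg: "degree ?f \<le> 1" using line_poly_top_coeff[OF fin(1), of ?ws b "\<lambda>i. a i c"] len True card by simp
      have "\<And>f :: real poly. degree f \<le> 1 \<Longrightarrow> f = [:coeff f 0, coeff f 1:]"
        by (intro poly_eqI) (auto simp: coeff_pCons coeff_eq_0 split: nat.splits)
      then obtain p q where pq: "?f = [:p, q:]" using deg that by blast
      have "poly ?f 0 = 0" unfolding poly_line_poly b0 using mixed_form_scale[OF fin(1), of ?ws 0 "\<lambda>_. 0"] len card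
        by simp
      then have "p = 0" using pq by simp
      have "poly ?f 1 = poly (pderiv ?f) 0" unfolding pq using \<open>p = 0\<close> by (simp add: pderiv_pCons)
      then show ?thesis unfolding pderiv_line_poly[OF fin(1)] poly_line_poly by simp
    qed
    then show ?thesis using IH[of 1] True by (simp add: gurvits_const_def)
  next
    case False
    then have "K \<noteq> {}" using cardK by auto
    have b: "b i > 0" if "i \<in> I" for i unfolding b_def
      using \<open>K \<noteq> {}\<close> K(3) that snoc.prems a by (intro sum_pos) (auto simp: K_def)
    define R where "R = mixed_form I ?ws b"
    have len_I: "length ?ws < card I" "card I - length ?ws = Suc k" using len card by auto
    have R: "R > 0" unfolding R_def
      by (rule mixed_form_pos[OF fin(1)]) (use apos b len_I in auto)
    have M': "?M' > 0"
      by (rule mixed_form_pos[OF fin(1)]) (use apos avpos b len_I in auto)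
    \<comment> \<open>For \<open>s = ?M' / R\<close> and \<open>m = k + 1\<close> the quotient
      \<open>(1 + t * s / m) ^ m / t\<close> is least at \<open>t * s = m / (m - 1)\<close>, which
      is \<open>y\<close>; the base of the power then equals \<open>y\<close> too.\<close>
    define y where "y = real (Suc k) / real k"
    have y: "y > 0" using False by (simp add: y_def)
    define t where "t = y * (R / ?M')"
    have t: "t > 0" unfolding t_def using R M' y by simp
    have "gurvits_const n (Suc k) * (t * X) \<le> mixed_form I ?ws (\<lambda>i. b i + t * a i c)" by (rule IH[OF t])
    also have "\<dots> \<le> R * (1 + t * (?M' / R) / real (Suc k)) ^ Suc k"
      unfolding R_def len_I(2)[symmetric]
      by (rule mixed_form_line_bound[where v = "\<lambda>i. a i c"])
         (fact fin len_I(1) b avpos less_imp_le[OF t] | erule (1) apos)+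
    also have "t * (?M' / R) = y" unfolding t_def using R M' by simp
    also have "y / real (Suc k) = 1 / real k"
      by (simp add: y_def del: of_nat_Suc)
    also have "1 + 1 / real k = y"
      unfolding y_def using False by (simp add: add_divide_distrib)
    finally have le: "gurvits_const n (Suc k) * (t * X) \<le> R * y ^ Suc k" .
    define u where "u = R / ?M'"
    have u: "u > 0" "R = u * ?M'" "t = y * u" using R M' by (auto simp: u_def t_def)
    have "gurvits_const n (Suc k) * (t * X) = (y * u) * (gurvits_const n (Suc k) * X)"
      unfolding u(3) by (simp only: mult_ac)
    moreover have "R * y ^ Suc k = (y * u) * (?M' * y ^ k)"
      unfolding u(2) power_Suc by (simp only: mult_ac)
    ultimately have "(y * u) * (gurvits_const n (Suc k) * X) \<le> (y * u) * (?M' * y ^ k)"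
      using le by (simp only:)
    then have "gurvits_const n (Suc k) * X \<le> ?M' * y ^ k"
      by (rule mult_left_le_imp_le) (use y u in simp)
    then have "gurvits_const n (Suc k) * X / y ^ k \<le> ?M'"
      using y by (subst pos_divide_le_eq) auto
    moreover have "gurvits_const n (Suc k) = gurvits_const n k * y ^ k"
      proof -
      have "real (Suc k) ^ Suc k / fact (Suc k) = real (Suc k) ^ k / fact k"
        by (simp del: of_nat_Suc)
      moreover have "real k ^ k / fact k * y ^ k = real (Suc k) ^ k / fact k"
        using False by (simp add: y_def power_divide del: of_nat_Suc)
      ultimately show ?thesis unfolding gurvits_const_def by (simp only: mult.assoc)
    qed
    ultimately show ?thesis using y by simp
  qed
  then show ?case by (simp add: b_def X_def K_def k_def)
qed

section \<open>Perfect matchings and permanents\<close>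

text \<open>The number of these is the permanent of a 0-1 matrix; extensionality makes
  \<open>card\<close> count each matching once. The column set \<open>J\<close> is kept apart from
  \<open>S\<close>, so that deleting a column changes only \<open>J\<close>.\<close>

definition matchings :: "'i set \<Rightarrow> 'j set \<Rightarrow> ('i \<Rightarrow> 'j set) \<Rightarrow> ('i \<Rightarrow> 'j) set" where
  "matchings I J S = {\<nu> \<in> I \<rightarrow>\<^sub>E J. bij_betw \<nu> I J \<and> (\<forall>i\<in>I. \<nu> i \<in> S i)}"

lemma finite_matchings: "finite I \<Longrightarrow> finite J \<Longrightarrow> finite (matchings I J S)"
  unfolding matchings_def by (rule finite_subset[of _ "I \<rightarrow>\<^sub>E J"]) (auto intro: finite_PiE)

lemma matchings_empty [simp]: "matchings {} {} S = {\<lambda>_. undefined}"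
  by (auto simp: matchings_def bij_betw_def)

lemma matchings_restrict:
  assumes "\<nu> \<in> matchings I J S" "i \<in> I"
  shows "restrict \<nu> (I - {i}) \<in> matchings (I - {i}) (J - {\<nu> i}) S"
proof -
  have "bij_betw \<nu> (I - {i}) (J - {\<nu> i})"
    using assms by (auto simp: matchings_def bij_betw_def inj_on_def)
  then have "bij_betw (restrict \<nu> (I - {i})) (I - {i}) (J - {\<nu> i})"
    by simp
  moreover from this have "restrict \<nu> (I - {i}) \<in> (I - {i}) \<rightarrow>\<^sub>E (J - {\<nu> i})"
    by (auto dest!: bij_betw_imp_funcset simp: Pi_iff)
  ultimately show ?thesis using assms(1) by (auto simp: matchings_def)
qed

lemma matchings_extend:
  assumes \<mu>: "\<mu> \<in> matchings (I - {i}) (J - {c}) S" and assms: "i \<in> I" "c \<in> J" "c \<in> S i"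
  shows "\<mu>(i := c) \<in> matchings I J S"
proof -
  from \<mu> have \<mu>': "inj_on \<mu> (I - {i})" "\<mu> ` (I - {i}) = J - {c}"
    by (auto simp: matchings_def bij_betw_def)
  have "(\<mu>(i := c)) ` I = J"
    unfolding fun_upd_image using assms \<mu>'(2) by auto
  moreover have "inj_on (\<mu>(i := c)) I"
  proof (rule inj_onI)
    fix x y assume xy: "x \<in> I" "y \<in> I" "(\<mu>(i := c)) x = (\<mu>(i := c)) y"
    have "\<mu> z \<noteq> c" if "z \<in> I - {i}" for z using \<mu>'(2) that by blast
    then show "x = y" using xy inj_onD[OF \<mu>'(1)] by (auto split: if_splits)
  qed
  ultimately have "bij_betw (\<mu>(i := c)) I J" by (simp add: bij_betw_def)
  then show ?thesis
    using \<mu> assms by (auto simp: matchings_def PiE_def extensional_def)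
qed

lemma card_matchings_through:
  assumes "i \<in> I" "c \<in> J" "c \<in> S i"
  shows "card {\<nu> \<in> matchings I J S. \<nu> i = c} = card (matchings (I - {i}) (J - {c}) S)"
proof (rule bij_betw_same_card)
  let ?A = "{\<nu> \<in> matchings I J S. \<nu> i = c}" and ?B = "matchings (I - {i}) (J - {c}) S"
  have "restrict \<nu> (I - {i}) \<in> ?B" if "\<nu> \<in> ?A" for \<nu>
    using that matchings_restrict[of \<nu> I J S i] assms(1) by simp
  moreover have "\<mu>(i := c) \<in> ?A" if "\<mu> \<in> ?B" for \<mu>
    using matchings_extend[OF that assms] by simp
  moreover have "(restrict \<nu> (I - {i}))(i := c) = \<nu>" if "\<nu> \<in> ?A" for \<nu>
  proof -
    have "\<nu> \<in> extensional I" "\<nu> i = c" using that by (auto simp: matchings_def PiE_def)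
    then show ?thesis by (auto simp: fun_eq_iff extensional_def)
  qed
  moreover have "restrict (\<mu>(i := c)) (I - {i}) = \<mu>" if "\<mu> \<in> ?B" for \<mu>
  proof -
    have "\<mu> \<in> extensional (I - {i})" using that by (auto simp: matchings_def PiE_def)
    then show ?thesis by (auto simp: fun_eq_iff extensional_def)
  qed
  ultimately show "bij_betw (\<lambda>\<nu>. restrict \<nu> (I - {i})) ?A ?B"
    by (intro bij_betwI[where g = "\<lambda>\<mu>. \<mu>(i := c)"]) blast+
qed

text \<open>Laplace expansion of the permanent along a row, used for Bregman's bound; the expansion
  along a column serves the mixed form.\<close>

lemma card_matchings_expand_row:
  assumes "finite I" "finite J" "i \<in> I"
  shows "card (matchings I J S) = (\<Sum>c\<in>S i \<inter> J. card (matchings (I - {i}) (J - {c}) S))"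
proof -
  have "(\<Union>c\<in>S i \<inter> J. {\<nu> \<in> matchings I J S. \<nu> i = c}) = matchings I J S"
    using assms by (auto simp: matchings_def)
  moreover have "card (\<Union>c\<in>S i \<inter> J. {\<nu> \<in> matchings I J S. \<nu> i = c})
      = (\<Sum>c\<in>S i \<inter> J. card {\<nu> \<in> matchings I J S. \<nu> i = c})"
    using assms finite_matchings[of I J S] by (intro card_UN_disjoint) auto
  ultimately show ?thesis using assms by (simp add: card_matchings_through)
qed

lemma card_matchings_expand_column:
  assumes "finite I" "finite J" "c \<in> J"
  shows "card (matchings I J S) = (\<Sum>i\<in>{i \<in> I. c \<in> S i}. card (matchings (I - {i}) (J - {c}) S))"
proof -
  have "\<exists>i\<in>I. c \<in> S i \<and> \<nu> i = c" if "\<nu> \<in> matchings I J S" for \<nu>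
  proof -
    have "c \<in> \<nu> ` I" using that assms by (auto simp: matchings_def bij_betw_def)
    then show ?thesis using that by (auto simp: matchings_def)
  qed
  then have "(\<Union>i\<in>{i \<in> I. c \<in> S i}. {\<nu> \<in> matchings I J S. \<nu> i = c}) = matchings I J S"
    by auto
  moreover have "card (\<Union>i\<in>{i \<in> I. c \<in> S i}. {\<nu> \<in> matchings I J S. \<nu> i = c})
      = (\<Sum>i\<in>{i \<in> I. c \<in> S i}. card {\<nu> \<in> matchings I J S. \<nu> i = c})"
  proof (rule card_UN_disjoint)
    show "\<forall>i\<in>{i \<in> I. c \<in> S i}. \<forall>i'\<in>{i \<in> I. c \<in> S i}. i \<noteq> i' \<longrightarrow>
        {\<nu> \<in> matchings I J S. \<nu> i = c} \<inter> {\<nu> \<in> matchings I J S. \<nu> i' = c} = {}"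
      by (auto simp: matchings_def bij_betw_def inj_on_def)
  qed (use assms finite_matchings[of I J S] in auto)
  ultimately show ?thesis using assms by (simp add: card_matchings_through)
qed

text \<open>One unfolding of \<open>mixed_form\<close> is the expansion of the permanent along
  column \<open>c\<close>. With as many columns as rows no linear factor survives, so the form is
  constant.\<close>

lemma mixed_form_incidence:
  assumes "finite I" "distinct cs" "card I = length cs"
  shows "mixed_form I (map (\<lambda>c i. of_bool (c \<in> S i)) cs) b = of_nat (card (matchings I (set cs) S))"
  using assms
proof (induction cs arbitrary: I)
  case Nil
  then show ?case by simp
next
  case (Cons c cs)
  let ?N = "\<lambda>i. card (matchings (I - {i}) (set cs) S)"
  have IH: "mixed_form (I - {i}) (map (\<lambda>c i. of_bool (c \<in> S i)) cs) b = of_nat (?N i)" if "i \<in> I" for i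
    using Cons.prems that by (intro Cons.IH) (auto simp: card_Diff_singleton)
  have "mixed_form I (map (\<lambda>c i. of_bool (c \<in> S i)) (c # cs)) b
      = (\<Sum>i\<in>I. of_bool (c \<in> S i) * of_nat (?N i))"
    by (auto intro!: sum.cong simp: IH)
  also have "\<dots> = (\<Sum>i\<in>{i \<in> I. c \<in> S i}. of_nat (?N i))"
    using Cons.prems by (intro sum.mono_neutral_cong_right) auto
  also have "\<dots> = of_nat (card (matchings I (set (c # cs)) S))"
  proof -
    have "set (c # cs) - {c} = set cs" using Cons.prems by auto
    then show ?thesis
      using card_matchings_expand_column[of I "set (c # cs)" c S] Cons.prems(1) by simp
  qed
  finally show ?case .
qed

text \<open>Divided by \<open>k\<close>, the incidence matrix is doubly stochastic, so its permanent
  should be at least \<open>fact n / real n ^ n\<close>. The capacity bound asks for positive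
  entries; hence the matrix is mixed with the uniform one with weight \<open>\<delta>\<close>, and
  \<open>\<delta>\<close> tends to \<open>0\<close>.\<close>

theorem regular_matchings_ge:
  assumes fin: "finite I" "finite J" and card: "card I = n" "card J = n" and "n > 0" "k > 0"
    and row: "\<And>i. i \<in> I \<Longrightarrow> card (S i \<inter> J) = k"
    and col: "\<And>c. c \<in> J \<Longrightarrow> card {i \<in> I. c \<in> S i} = k"
  shows "fact n * (real k / real n) ^ n \<le> real (card (matchings I J S))"
proof -
  define a :: "_ \<Rightarrow> _ \<Rightarrow> real" where "a = (\<lambda>i c. 1 / real k * of_bool (c \<in> S i))"
  define a' where "a' = (\<lambda>\<delta> i c. (1 - \<delta>) * a i c + \<delta> / real n)"
  obtain cs where cs: "distinct cs" "set cs = J" using finite_distinct_list[OF fin(2)] by metis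
  have len: "length cs = n" using cs card distinct_card by metis
  have "(\<Sum>c\<in>J. a i c) = card (S i \<inter> J) / real k" if "i \<in> I" for i
    unfolding a_def sum_distrib_left[symmetric] using fin by (simp add: Int_commute)
  then have rsum: "(\<Sum>c\<in>J. a i c) = 1" if "i \<in> I" for i using that row \<open>k > 0\<close> by simp
  have "(\<Sum>i\<in>I. a i c) = card {i \<in> I. c \<in> S i} / real k" for c
    unfolding a_def sum_distrib_left[symmetric] using fin by (simp add: Collect_conj_eq)
  then have csum: "(\<Sum>i\<in>I. a i c) = 1" if "c \<in> J" for c using that col \<open>k > 0\<close> by simp
  have ge: "fact n / real n ^ n \<le> mixed_form I (map (\<lambda>c i. a' \<delta> i c) cs) (\<lambda>i. 0)" if "0 < \<delta>" "\<delta> < 1" for \<delta>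
  proof -
    have "gurvits_const n (n - length cs) * (\<Prod>j\<in>J - set cs. 1)
     \<le> mixed_form I (map (\<lambda>j i. a' \<delta> i j) cs) (\<lambda>i. \<Sum>j\<in>J - set cs. a' \<delta> i j * 1)"
    proof (rule capacity_bound[OF fin card])
      show "a' \<delta> i j > 0" for i j using that \<open>n > 0\<close> by (auto simp: a'_def a_def intro!: add_nonneg_pos)
      show "(\<Sum>j\<in>J. a' \<delta> i j) = 1" if "i \<in> I" for i
        using rsum[OF that] card \<open>n > 0\<close> by (simp add: a'_def sum.distrib sum_distrib_left[symmetric])
      show "(\<Sum>i\<in>I. a' \<delta> i j) = 1" if "j \<in> J" for j
        using csum[OF that] card \<open>n > 0\<close> by (simp add: a'_def sum.distrib sum_distrib_left[symmetric])
    qed (use cs in auto)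
    then show ?thesis using len cs by (simp add: gurvits_const_def)
  qed
  have "((\<lambda>\<delta>. mixed_form I (map (\<lambda>c i. a' \<delta> i c) cs) (\<lambda>i. 0)) \<longlongrightarrow> mixed_form I (map (\<lambda>c i. a i c) cs) (\<lambda>i. 0)) (at_right 0)"
  proof -
    have "((\<lambda>\<delta>. mixed_form I (map ((\<lambda>\<delta> w i. (1 - \<delta>) * w i + \<delta> / real n) \<delta>) (map (\<lambda>c i. a i c) cs)) (\<lambda>i. 0))
       \<longlongrightarrow> mixed_form I (map (\<lambda>w. w) (map (\<lambda>c i. a i c) cs)) (\<lambda>i. 0)) (at_right 0)"
      using \<open>n > 0\<close> by (intro tendsto_mixed_form) (auto intro!: tendsto_eq_intros)
    then show ?thesis by (simp add: a'_def comp_def)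
  qed
  moreover have "eventually (\<lambda>\<delta>. fact n / real n ^ n \<le> mixed_form I (map (\<lambda>c i. a' \<delta> i c) cs) (\<lambda>i. 0)) (at_right 0)"
    using eventually_at_right_real[OF zero_less_one] by (rule eventually_mono) (auto intro: ge)
  ultimately have "fact n / real n ^ n \<le> mixed_form I (map (\<lambda>c i. a i c) cs) (\<lambda>i. 0)"
    by (rule tendsto_lowerbound) simp
  also have "map (\<lambda>c i. a i c) cs = map (\<lambda>w i. 1 / real k * w i) (map (\<lambda>c i. of_bool (c \<in> S i)) cs)"
    by (simp add: a_def comp_def)
  also have "mixed_form I \<dots> (\<lambda>i. 0) = (1 / real k) ^ n * real (card (matchings I J S))"
    unfolding mixed_form_scale_list using mixed_form_incidence[OF fin(1) cs(1), of S "\<lambda>i. 0 :: real"] card len cs by simp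
  finally have "fact n / real n ^ n * real k ^ n \<le> real (card (matchings I J S))"
    using \<open>k > 0\<close> by (simp add: power_divide pos_le_divide_eq)
  then show ?thesis by (simp add: power_divide)
qed

section \<open>Bregman's bound for permanents\<close>

text \<open>The logarithm of \<open>fact r powr (1 / r)\<close>, the contribution of a row with
  \<open>r\<close> options to Bregman's bound. Division by zero makes it \<open>0\<close> at
  \<open>r = 0\<close>.\<close>

definition log_fact_mean :: "nat \<Rightarrow> real" where
  "log_fact_mean r = ln (fact r) / real r"

lemma of_nat_mult_log_fact_mean: "real r * log_fact_mean r = ln (fact r)"
  by (cases "r = 0") (auto simp: log_fact_mean_def)

text \<open>Jensen's inequality for \<open>t * ln t\<close>, obtained by summing its tangent line at
  the mean \<open>N / card A\<close>.\<close>

lemma sum_mult_ln_ge: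
  fixes p :: "'a \<Rightarrow> real"
  assumes "finite A" "\<And>x. x \<in> A \<Longrightarrow> p x \<ge> 0" and N: "(\<Sum>x\<in>A. p x) = N" "N > 0"
  shows "N * ln N \<le> N * ln (real (card A)) + (\<Sum>x\<in>A. p x * ln (p x))"
proof -
  define r where "r = real (card A)"
  have "A \<noteq> {}" using N by auto
  then have r: "r > 0" using assms(1) by (simp add: r_def card_gt_0_iff)
  have le: "p x - N / r \<le> p x * ln (p x) - p x * ln (N / r)" if "x \<in> A" for x
  proof (cases "p x = 0")
    case True
    then show ?thesis using N r by simp
  next
    case False
    then have p: "p x > 0" using assms(2)[OF that] by simp
    have "ln (N / r / p x) \<le> N / r / p x - 1" using N r p by (intro ln_le_minus_one) auto
    moreover have "ln (N / r / p x) = ln (N / r) - ln (p x)" using N r p by (subst ln_div) auto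
    ultimately have "p x * (ln (N / r) - ln (p x)) \<le> p x * (N / r / p x - 1)"
      using p by (intro mult_left_mono) auto
    also have "\<dots> = N / r - p x" using p by (simp add: right_diff_distrib)
    finally have "p x * (ln (N / r) - ln (p x)) \<le> N / r - p x" .
    then show ?thesis using p by (simp add: algebra_simps)
  qed
  have "0 = (\<Sum>x\<in>A. p x - N / r)" using N r by (simp add: sum_subtractf r_def)
  also have "\<dots> \<le> (\<Sum>x\<in>A. p x * ln (p x) - p x * ln (N / r))" by (intro sum_mono le)
  also have "\<dots> = (\<Sum>x\<in>A. p x * ln (p x)) - N * ln (N / r)"
    by (simp add: sum_subtractf sum_distrib_right[symmetric] N)
  finally show ?thesis using N r by (simp add: ln_div algebra_simps r_def)
qed

text \<open>The quantity \<open>n * N * ln N\<close> is bounded as a sum over rows \<open>i\<close>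
  and matchings \<open>\<nu>\<close>. Convexity of \<open>t * ln t\<close> treats one row over all
  matchings; the induction hypothesis, after deletion of row \<open>i\<close> and column
  \<open>\<nu> i\<close>, treats one matching over all rows.\<close>

theorem bregman_minc:
  assumes "finite I" "finite J" "matchings I J S \<noteq> {}"
  shows "ln (real (card (matchings I J S))) \<le> (\<Sum>i\<in>I. log_fact_mean (card (S i \<inter> J)))"
  using assms
proof (induction "card I" arbitrary: I J)
  case 0
  then have "I = {}" by simp
  then have "J = {}" using 0 by (auto simp: matchings_def bij_betw_def)
  then show ?case using \<open>I = {}\<close> by simp
next
  case (Suc m)
  define M where "M = matchings I J S"
  define N where "N = real (card M)"
  define n where "n = card I"
  define r where "r = (\<lambda>i. card (S i \<inter> J))"
  define P where "P = (\<lambda>i c. real (card (matchings (I - {i}) (J - {c}) S)))"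
  have finM: "finite M" unfolding M_def using Suc by (intro finite_matchings)
  have N: "N > 0" unfolding N_def using Suc finM by (simp add: card_gt_0_iff M_def)
  have row: "N * ln N \<le> (\<Sum>\<nu>\<in>M. ln (real (r i)) + ln (P i (\<nu> i)))" if "i \<in> I" for i
  proof -
    have "(\<Sum>c\<in>S i \<inter> J. P i c) = N"
      using card_matchings_expand_row[OF Suc.prems(1,2) that, of S] by (simp add: P_def N_def M_def)
    then have "N * ln N \<le> N * ln (real (r i)) + (\<Sum>c\<in>S i \<inter> J. P i c * ln (P i c))"
      unfolding r_def using Suc.prems N by (intro sum_mult_ln_ge) (auto simp: P_def)
    \<comment> \<open>Exactly \<open>P i c\<close> matchings send \<open>i\<close> to
      \<open>c\<close>, so each term is a sum of equal logarithms over these matchings.\<close>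
    also have "(\<Sum>c\<in>S i \<inter> J. P i c * ln (P i c)) = (\<Sum>c\<in>S i \<inter> J. \<Sum>\<nu>\<in>{\<nu> \<in> M. \<nu> i = c}. ln (P i (\<nu> i)))"
      using that by (intro sum.cong) (auto simp: P_def M_def card_matchings_through)
    also have "\<dots> = (\<Sum>\<nu>\<in>M. ln (P i (\<nu> i)))"
      using Suc.prems finM that by (intro sum.group) (auto simp: M_def matchings_def)
    finally show ?thesis by (simp add: sum.distrib N_def)
  qed
  have per_matching: "(\<Sum>i\<in>I. ln (real (r i)) + ln (P i (\<nu> i))) \<le> n * (\<Sum>j\<in>I. log_fact_mean (r j))"
    if \<nu>: "\<nu> \<in> M" for \<nu>
  proof -
    have \<nu>': "\<And>i. i \<in> I \<Longrightarrow> \<nu> i \<in> S i \<inter> J" "inj_on \<nu> I" "\<nu> ` I = J"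
      using \<nu> by (auto simp: M_def matchings_def bij_betw_def)
    \<comment> \<open>Deleting column \<open>\<nu> i\<close> costs row \<open>j\<close> one option
      exactly when \<open>\<nu> i\<close> was among its options. The restriction of
      \<open>\<nu>\<close> shows that the smaller problem still has a matching.\<close>
    have IH: "ln (P i (\<nu> i)) \<le> (\<Sum>j\<in>I - {i}. log_fact_mean (r j - of_bool (\<nu> i \<in> S j)))" if "i \<in> I" for i
    proof -
      have "ln (P i (\<nu> i)) \<le> (\<Sum>j\<in>I - {i}. log_fact_mean (card (S j \<inter> (J - {\<nu> i}))))"
        unfolding P_def
      proof (rule Suc.hyps(1))
        show "matchings (I - {i}) (J - {\<nu> i}) S \<noteq> {}"
          using matchings_restrict[of \<nu> I J S i] \<nu> that by (auto simp: M_def)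
      qed (use Suc.prems Suc.hyps(2) that in \<open>auto simp: card_Diff_singleton\<close>)
      moreover have "card (S j \<inter> (J - {\<nu> i})) = r j - of_bool (\<nu> i \<in> S j)" for j
      proof (cases "\<nu> i \<in> S j")
        case True
        then have "S j \<inter> (J - {\<nu> i}) = S j \<inter> J - {\<nu> i}" "\<nu> i \<in> S j \<inter> J" using \<nu>'(1)[OF that] by auto
        then show ?thesis using True by (simp add: r_def card_Diff_singleton)
      next
        case False
        then have "S j \<inter> (J - {\<nu> i}) = S j \<inter> J" by auto
        then show ?thesis using False by (simp add: r_def)
      qed
      ultimately show ?thesis by (simp only:)
    qed
    \<comment> \<open>As \<open>\<nu>\<close> is a bijection onto \<open>J\<close>,
      \<open>\<nu> i\<close> lies in \<open>S j\<close> for exactly \<open>r j\<close> rows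
      \<open>i\<close>, one of which is \<open>j\<close>. Hence \<open>r j - 1\<close> summands have
      one option fewer and \<open>n - r j\<close> are unchanged.\<close>
    have column: "(\<Sum>i\<in>I - {j}. log_fact_mean (r j - of_bool (\<nu> i \<in> S j)))
        = ln (fact (r j - 1)) + (real n - real (r j)) * log_fact_mean (r j)" and rpos: "r j \<ge> 1" if "j \<in> I" for j
    proof -
      have "bij_betw \<nu> {i \<in> I. \<nu> i \<in> S j} (S j \<inter> J)"
        using \<nu>'(2,3) by (auto simp: bij_betw_def inj_on_def)
      then have cr: "card {i \<in> I. \<nu> i \<in> S j} = r j" by (simp add: r_def bij_betw_same_card)
      have jin: "j \<in> {i \<in> I. \<nu> i \<in> S j}" using that \<nu>'(1) by auto
      have "{i \<in> I - {j}. \<nu> i \<in> S j} = {i \<in> I. \<nu> i \<in> S j} - {j}" by auto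
      then have c1: "card {i \<in> I - {j}. \<nu> i \<in> S j} = r j - 1"
        by (simp only: card_Diff_singleton[OF jin] cr)
      have "0 < card {i \<in> I. \<nu> i \<in> S j}"
        using jin Suc.prems(1) by (subst card_gt_0_iff) auto
      then show r1: "r j \<ge> 1" using cr by linarith
      have *: "card {i \<in> I - {j}. \<nu> i \<in> S j} + card {i \<in> I - {j}. \<nu> i \<notin> S j} = card (I - {j})"
      proof -
        have "card ({i \<in> I - {j}. \<nu> i \<in> S j} \<union> {i \<in> I - {j}. \<nu> i \<notin> S j})
            = card {i \<in> I - {j}. \<nu> i \<in> S j} + card {i \<in> I - {j}. \<nu> i \<notin> S j}"
          by (rule card_Un_disjoint) (use Suc.prems(1) in auto)
        moreover have "{i \<in> I - {j}. \<nu> i \<in> S j} \<union> {i \<in> I - {j}. \<nu> i \<notin> S j} = I - {j}" by auto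
        ultimately show ?thesis by (simp only:)
      qed
      then have c2: "real (card {i \<in> I - {j}. \<nu> i \<notin> S j}) = real n - real (r j)"
      proof -
        have "card (I - {j}) = n - 1" using that by (simp add: card_Diff_singleton n_def)
        moreover have "n \<ge> 1" using Suc.hyps(2) by (simp add: n_def)
        ultimately show ?thesis using * c1 r1 by linarith
      qed
      have "(\<Sum>i\<in>I - {j}. log_fact_mean (r j - of_bool (\<nu> i \<in> S j)))
         = (\<Sum>i\<in>{i \<in> I - {j}. \<nu> i \<in> S j}. log_fact_mean (r j - 1)) + (\<Sum>i\<in>{i \<in> I - {j}. \<nu> i \<notin> S j}. log_fact_mean (r j))"
      proof -
        let ?g = "\<lambda>i. log_fact_mean (r j - of_bool (\<nu> i \<in> S j))"
        have "sum ?g (I - {j}) = sum ?g ({i \<in> I - {j}. \<nu> i \<in> S j} \<union> {i \<in> I - {j}. \<nu> i \<notin> S j})"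
          by (rule sum.cong) auto
        also have "\<dots> = sum ?g {i \<in> I - {j}. \<nu> i \<in> S j} + sum ?g {i \<in> I - {j}. \<nu> i \<notin> S j}"
          by (rule sum.union_disjoint) (use Suc.prems(1) in auto)
        also have "\<dots> = (\<Sum>i\<in>{i \<in> I - {j}. \<nu> i \<in> S j}. log_fact_mean (r j - 1)) + (\<Sum>i\<in>{i \<in> I - {j}. \<nu> i \<notin> S j}. log_fact_mean (r j))"
          by (intro arg_cong2[where f = "(+)"] sum.cong) auto
        finally show ?thesis .
      qed
      also have "\<dots> = real (r j - 1) * log_fact_mean (r j - 1) + (real n - real (r j)) * log_fact_mean (r j)"
        by (simp only: sum_constant c1 c2)
      finally show "(\<Sum>i\<in>I - {j}. log_fact_mean (r j - of_bool (\<nu> i \<in> S j)))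
        = ln (fact (r j - 1)) + (real n - real (r j)) * log_fact_mean (r j)"
        by (simp only: of_nat_mult_log_fact_mean)
    qed
    have "(\<Sum>i\<in>I. ln (real (r i)) + ln (P i (\<nu> i)))
       \<le> (\<Sum>i\<in>I. ln (real (r i))) + (\<Sum>i\<in>I. \<Sum>j\<in>I - {i}. log_fact_mean (r j - of_bool (\<nu> i \<in> S j)))"
      unfolding sum.distrib using IH by (intro add_left_mono sum_mono) auto
    also have "(\<Sum>i\<in>I. \<Sum>j\<in>I - {i}. log_fact_mean (r j - of_bool (\<nu> i \<in> S j)))
       = (\<Sum>j\<in>I. \<Sum>i\<in>I - {j}. log_fact_mean (r j - of_bool (\<nu> i \<in> S j)))"
    proof -
      let ?g = "\<lambda>i j. log_fact_mean (r j - of_bool (\<nu> i \<in> S j))"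
      have "(\<Sum>i\<in>I. \<Sum>j\<in>I - {i}. ?g i j) = (\<Sum>i\<in>I. \<Sum>j\<in>{j \<in> I. i \<noteq> j}. ?g i j)"
        by (intro sum.cong) auto
      also have "\<dots> = (\<Sum>j\<in>I. \<Sum>i\<in>{i \<in> I. i \<noteq> j}. ?g i j)"
        by (rule sum.swap_restrict) (fact Suc.prems(1))+
      also have "\<dots> = (\<Sum>j\<in>I. \<Sum>i\<in>I - {j}. ?g i j)"
        by (intro sum.cong) auto
      finally show ?thesis .
    qed
    also have "(\<Sum>i\<in>I. ln (real (r i))) + \<dots> = (\<Sum>j\<in>I. real n * log_fact_mean (r j))"
      unfolding sum.distrib[symmetric]
    proof (intro sum.cong refl)
      fix j assume j: "j \<in> I"
      obtain q where q: "r j = Suc q" using rpos[OF j] by (metis Suc_le_D One_nat_def)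
      have "ln (real (r j)) + ln (fact (r j - 1)) = ln (fact (r j))"
        unfolding q fact_Suc by (simp add: ln_mult_pos del: of_nat_Suc)
      then show "ln (real (r j)) + (\<Sum>i\<in>I - {j}. log_fact_mean (r j - of_bool (\<nu> i \<in> S j))) = real n * log_fact_mean (r j)"
        unfolding column[OF j] using of_nat_mult_log_fact_mean[of "r j"] by (simp add: algebra_simps)
    qed
    finally show ?thesis by (simp add: sum_distrib_left)
  qed
  have "n * (N * ln N) \<le> (\<Sum>i\<in>I. \<Sum>\<nu>\<in>M. ln (real (r i)) + ln (P i (\<nu> i)))"
    using sum_mono[OF row, of I] by (simp add: n_def)
  also have "\<dots> = (\<Sum>\<nu>\<in>M. \<Sum>i\<in>I. ln (real (r i)) + ln (P i (\<nu> i)))" by (rule sum.swap)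
  also have "\<dots> \<le> (\<Sum>\<nu>\<in>M. n * (\<Sum>j\<in>I. log_fact_mean (r j)))" by (intro sum_mono per_matching)
  also have "\<dots> = (real n * N) * (\<Sum>j\<in>I. log_fact_mean (r j))" unfolding N_def by simp
  finally have "(real n * N) * ln N \<le> (real n * N) * (\<Sum>j\<in>I. log_fact_mean (r j))" by (simp only: mult.assoc)
  then have "ln N \<le> (\<Sum>j\<in>I. log_fact_mean (r j))"
    by (rule mult_left_le_imp_le) (use N Suc.hyps(2) in \<open>simp add: n_def\<close>)
  then show ?case by (simp add: N_def M_def r_def)
qed

section \<open>Counting Latin rectangles\<close>

text \<open>The rows are indexed by an arbitrary set, so that they can be filled in any order;
  \<open>W i j\<close> holds the symbols permitted in a cell. Columns are only injective, as the
  rectangle may be incomplete.\<close>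

definition latin_rectangles :: "nat \<Rightarrow> (nat \<Rightarrow> nat \<Rightarrow> nat set) \<Rightarrow> nat set \<Rightarrow> (nat \<Rightarrow> nat \<Rightarrow> nat) set" where
  "latin_rectangles n W R =
     {g \<in> (\<Pi>\<^sub>E i\<in>R. matchings {..<n} {..<n} (W i)). \<forall>j<n. inj_on (\<lambda>i. g i j) R}"

lemma finite_latin_rectangles: "finite R \<Longrightarrow> finite (latin_rectangles n W R)"
  unfolding latin_rectangles_def
  by (rule finite_subset[of _ "\<Pi>\<^sub>E i\<in>R. matchings {..<n} {..<n} (W i)"]) (auto intro!: finite_PiE finite_matchings)

lemma latin_rectangles_empty [simp]: "latin_rectangles n W {} = {\<lambda>_. undefined}"
  by (auto simp: latin_rectangles_def)

lemma matching_less: "\<nu> \<in> matchings {..<n} {..<n} S \<Longrightarrow> j < n \<Longrightarrow> \<nu> j < n"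
  by (auto simp: matchings_def)

lemma card_latin_rectangles_insert:
  assumes "finite R" "r \<notin> R"
  shows "card (latin_rectangles n W (insert r R)) =
    (\<Sum>g\<in>latin_rectangles n W R. card (matchings {..<n} {..<n} (\<lambda>j. W r j - (\<lambda>i. g i j) ` R)))"
proof -
  let ?E = "\<lambda>g. matchings {..<n} {..<n} (\<lambda>j. W r j - (\<lambda>i. g i j) ` R)"
  let ?h = "\<lambda>(g, \<nu>). g(r := \<nu>)"
  have "bij_betw ?h (Sigma (latin_rectangles n W R) ?E) (latin_rectangles n W (insert r R))"
  proof (rule bij_betw_imageI)
    show "inj_on ?h (Sigma (latin_rectangles n W R) ?E)"
    proof (rule inj_onI, clarify)
      fix g \<nu> g' \<nu>'
      assume *: "g \<in> latin_rectangles n W R" "g' \<in> latin_rectangles n W R" "g(r := \<nu>) = g'(r := \<nu>')"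
      have "g x = g' x" for x
      proof (cases "x = r")
        case True
        then show ?thesis using * assms(2) by (auto simp: latin_rectangles_def PiE_def extensional_def)
      next
        case False
        then show ?thesis using fun_cong[OF *(3), of x] by simp
      qed
      moreover have "\<nu> = \<nu>'" using fun_cong[OF *(3), of r] by simp
      ultimately show "g = g' \<and> \<nu> = \<nu>'" by auto
    qed
    show "?h ` Sigma (latin_rectangles n W R) ?E = latin_rectangles n W (insert r R)"
    proof (intro equalityI subsetI)
      fix f assume "f \<in> ?h ` Sigma (latin_rectangles n W R) ?E"
      then obtain g \<nu> where g: "g \<in> latin_rectangles n W R" and \<nu>: "\<nu> \<in> ?E g" and f: "f = g(r := \<nu>)" by auto
      have "\<nu> \<in> matchings {..<n} {..<n} (W r)" using \<nu> unfolding matchings_def by blast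
      then have "f \<in> (\<Pi>\<^sub>E i\<in>insert r R. matchings {..<n} {..<n} (W i))"
        using g unfolding f latin_rectangles_def by (intro PiE_fun_upd) auto
      moreover have "inj_on (\<lambda>i. f i j) (insert r R)" if "j < n" for j
      proof -
        have inj: "inj_on (\<lambda>i. g i j) R" using g that by (simp add: latin_rectangles_def)
        have "\<nu> j \<in> W r j - (\<lambda>i. g i j) ` R" using \<nu> that unfolding matchings_def by blast
        then have new: "\<nu> j \<noteq> g i j" if "i \<in> R" for i using that by blast
        show ?thesis
        proof (rule inj_onI)
          fix x y assume xy: "x \<in> insert r R" "y \<in> insert r R" "f x j = f y j"
          have "f z j = (if z = r then \<nu> j else g z j)" for z by (simp add: f)
          then show "x = y" using xy inj_onD[OF inj, of x y] new[of x] new[of y] by (metis insertE)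
        qed
      qed
      ultimately show "f \<in> latin_rectangles n W (insert r R)" by (simp add: latin_rectangles_def)
    next
      fix f assume f: "f \<in> latin_rectangles n W (insert r R)"
      \<comment> \<open>Resetting row \<open>r\<close> to \<open>undefined\<close> makes the
        function extensional on \<open>R\<close>.\<close>
      define g where "g = f(r := undefined)"
      have gR: "g i = f i" if "i \<in> R" for i using that assms(2) by (auto simp: g_def)
      have img: "(\<lambda>i. g i j) ` R = (\<lambda>i. f i j) ` R" for j using gR by (intro image_cong) auto
      have "g \<in> latin_rectangles n W R"
      proof -
        have "g \<in> (\<Pi>\<^sub>E i\<in>R. matchings {..<n} {..<n} (W i))"
        proof (rule PiE_I)
          fix i assume "i \<in> R" then show "g i \<in> matchings {..<n} {..<n} (W i)"
            using f gR by (auto simp: latin_rectangles_def)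
        next
          fix i assume "i \<notin> R" then show "g i = undefined"
            using f by (auto simp: latin_rectangles_def g_def PiE_def extensional_def)
        qed
        moreover have "inj_on (\<lambda>i. g i j) R" if "j < n" for j
        proof -
          have "inj_on (\<lambda>i. f i j) R" using f that by (auto simp: latin_rectangles_def)
          then show ?thesis using gR by (auto simp: inj_on_def)
        qed
        ultimately show ?thesis by (simp add: latin_rectangles_def)
      qed
      moreover have "f r \<in> ?E g"
      proof -
        have "f r j \<notin> (\<lambda>i. f i j) ` R" if "j < n" for j
          using f that assms(2) by (auto simp: latin_rectangles_def)
        moreover have "f r \<in> matchings {..<n} {..<n} (W r)" using f by (auto simp: latin_rectangles_def)
        ultimately show ?thesis unfolding img by (auto simp: matchings_def)
      qed
      moreover have "f = ?h (g, f r)" by (auto simp: g_def)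
      ultimately show "f \<in> ?h ` Sigma (latin_rectangles n W R) ?E" by blast
    qed
  qed
  then have "card (latin_rectangles n W (insert r R)) = card (Sigma (latin_rectangles n W R) ?E)"
    by (rule bij_betw_same_card[symmetric])
  also have "\<dots> = (\<Sum>g\<in>latin_rectangles n W R. card (?E g))"
    using assms(1) by (intro card_SigmaI finite_latin_rectangles) (auto intro!: finite_matchings)
  finally show ?thesis .
qed

section \<open>Available symbols and the lower bound\<close>

lemma card_used_symbols:
  assumes "g \<in> latin_rectangles n W R" "j < n"
  shows "card ((\<lambda>i. g i j) ` R) = card R" "(\<lambda>i. g i j) ` R \<subseteq> {..<n}"
proof -
  show "card ((\<lambda>i. g i j) ` R) = card R" using assms by (auto simp: latin_rectangles_def intro: card_image)
  show "(\<lambda>i. g i j) ` R \<subseteq> {..<n}"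
    using assms matching_less by (fastforce simp: latin_rectangles_def)
qed

text \<open>Each row of \<open>R\<close> is a permutation and has \<open>c\<close> in one column
  \<open>p i\<close>, and no column has \<open>c\<close> twice, so \<open>p\<close> is injective.
  This gives regularity on the side of the symbols.\<close>

lemma card_columns_using_symbol:
  assumes g: "g \<in> latin_rectangles n W R" and c: "c < n"
  shows "card {j \<in> {..<n}. c \<in> (\<lambda>i. g i j) ` R} = card R"
proof -
  have bij: "bij_betw (g i) {..<n} {..<n}" if "i \<in> R" for i
    using g that by (auto simp: latin_rectangles_def matchings_def)
  define p where "p = (\<lambda>i. inv_into {..<n} (g i) c)"
  have p: "p i < n" "g i (p i) = c" if "i \<in> R" for i
  proof -
    have "c \<in> g i ` {..<n}" using bij[OF that] c by (simp add: bij_betw_def)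
    then show "p i < n" "g i (p i) = c"
      using inv_into_into[of c "g i" "{..<n}"] f_inv_into_f[of c "g i" "{..<n}"] by (auto simp: p_def)
  qed
  have p_unique: "j = p i" if "i \<in> R" "j < n" "g i j = c" for i j
    using bij[OF that(1)] p[OF that(1)] that by (auto simp: bij_betw_def inj_on_def)
  have "inj_on p R"
  proof (rule inj_onI)
    fix i i' assume "i \<in> R" "i' \<in> R" "p i = p i'"
    then have "g i (p i) = g i' (p i)" using p by metis
    moreover have "inj_on (\<lambda>k. g k (p i)) R"
      using g p(1)[OF \<open>i \<in> R\<close>] by (simp add: latin_rectangles_def)
    ultimately show "i = i'" using \<open>i \<in> R\<close> \<open>i' \<in> R\<close> by (meson inj_onD)
  qed
  moreover have "{j \<in> {..<n}. c \<in> (\<lambda>i. g i j) ` R} = p ` R"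
    using p p_unique by (auto simp: image_iff) (metis)+
  ultimately show ?thesis by (simp add: card_image)
qed

lemma card_latin_rectangles_ge:
  assumes "m \<le> n"
  shows "(\<Prod>k<m. fact n * (real (n - k) / real n) ^ n) \<le> real (card (latin_rectangles n (\<lambda>_ _. UNIV) {..<m}))"
  using assms
proof (induction m)
  case (Suc m)
  have "fact n * (real (n - m) / real n) ^ n \<le> real (card (matchings {..<n} {..<n} (\<lambda>j. UNIV - (\<lambda>i. g i j) ` {..<m})))"
    if g: "g \<in> latin_rectangles n (\<lambda>_ _. UNIV) {..<m}" for g
  proof (rule regular_matchings_ge)
    fix j assume j: "j \<in> {..<n}"
    have "(UNIV - (\<lambda>i. g i j) ` {..<m}) \<inter> {..<n} = {..<n} - (\<lambda>i. g i j) ` {..<m}" by auto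
    then show "card ((UNIV - (\<lambda>i. g i j) ` {..<m}) \<inter> {..<n}) = n - m"
      using card_used_symbols[OF g, of j] j by (simp add: card_Diff_subset)
  next
    fix c assume c: "c \<in> {..<n}"
    have "{j \<in> {..<n}. c \<in> UNIV - (\<lambda>i. g i j) ` {..<m}} = {..<n} - {j \<in> {..<n}. c \<in> (\<lambda>i. g i j) ` {..<m}}" by auto
    then show "card {j \<in> {..<n}. c \<in> UNIV - (\<lambda>i. g i j) ` {..<m}} = n - m"
      using card_columns_using_symbol[OF g, of c] c by (simp only:) (subst card_Diff_subset, auto)
  qed (use Suc.prems in auto)
  then have "(\<Sum>g\<in>latin_rectangles n (\<lambda>_ _. UNIV) {..<m}. fact n * (real (n - m) / real n) ^ n)
     \<le> (\<Sum>g\<in>latin_rectangles n (\<lambda>_ _. UNIV) {..<m}. real (card (matchings {..<n} {..<n} (\<lambda>j. UNIV - (\<lambda>i. g i j) ` {..<m}))))"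
    by (intro sum_mono) auto
  also have "\<dots> = real (card (latin_rectangles n (\<lambda>_ _. UNIV) {..<Suc m}))"
    unfolding lessThan_Suc by (subst card_latin_rectangles_insert) auto
  finally have step: "real (card (latin_rectangles n (\<lambda>_ _. UNIV) {..<m})) * (fact n * (real (n - m) / real n) ^ n)
      \<le> real (card (latin_rectangles n (\<lambda>_ _. UNIV) {..<Suc m}))" by simp
  have "(\<Prod>k<Suc m. fact n * (real (n - k) / real n) ^ n)
      \<le> real (card (latin_rectangles n (\<lambda>_ _. UNIV) {..<m})) * (fact n * (real (n - m) / real n) ^ n)"
    unfolding prod.lessThan_Suc using Suc by (intro mult_right_mono) auto
  then show ?case using step by linarith
qed simp

section \<open>Upper bounds with a forbidden block\<close>

text \<open>Bregman's bound sees only the numbers of available symbols. In the applications these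
  depend only on how many rows are filled, hence one \<open>b\<close> for all
  \<open>g\<close>.\<close>

lemma card_latin_rectangles_insert_le:
  assumes "finite R" "r \<notin> R"
    and "\<And>g. g \<in> latin_rectangles n W R \<Longrightarrow>
       (\<Sum>j<n. log_fact_mean (card ((W r j - (\<lambda>i. g i j) ` R) \<inter> {..<n}))) = b"
  shows "real (card (latin_rectangles n W (insert r R))) \<le> real (card (latin_rectangles n W R)) * exp b"
proof -
  have "real (card (matchings {..<n} {..<n} (\<lambda>j. W r j - (\<lambda>i. g i j) ` R))) \<le> exp b"
    if g: "g \<in> latin_rectangles n W R" for g
  proof (cases "matchings {..<n} {..<n} (\<lambda>j. W r j - (\<lambda>i. g i j) ` R) = {}")
    case False
    then have "card (matchings {..<n} {..<n} (\<lambda>j. W r j - (\<lambda>i. g i j) ` R)) > 0"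
      by (simp add: card_gt_0_iff finite_matchings)
    moreover have "ln (real (card (matchings {..<n} {..<n} (\<lambda>j. W r j - (\<lambda>i. g i j) ` R)))) \<le> b"
      using bregman_minc[OF _ _ False] assms(3)[OF g] by simp
    ultimately show ?thesis by (metis exp_le_cancel_iff exp_ln of_nat_0_less_iff)
  qed simp
  then have "(\<Sum>g\<in>latin_rectangles n W R. real (card (matchings {..<n} {..<n} (\<lambda>j. W r j - (\<lambda>i. g i j) ` R))))
      \<le> (\<Sum>g\<in>latin_rectangles n W R. exp b)" by (intro sum_mono)
  then show ?thesis using card_latin_rectangles_insert[OF assms(1,2), of n W] by simp
qed

text \<open>The value is the set of symbols that stay permitted, as \<open>latin_rectangles\<close>
  expects.\<close>

definition forbid :: "nat set \<Rightarrow> nat set \<Rightarrow> nat set \<Rightarrow> nat \<Rightarrow> nat \<Rightarrow> nat set" where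
  "forbid A B C i j = (if i \<in> A \<and> j \<in> B then - C else UNIV)"

text \<open>In a column of \<open>B\<close> the earlier rows, lying in \<open>A\<close>, avoided
  \<open>C\<close> as well. Their symbols come out of the \<open>n - d\<close> others, so the loss
  of \<open>d\<close> options persists through all rows of \<open>A\<close>; this is why these rows
  come first.\<close>

lemma card_latin_rectangles_forbid_inside:
  assumes B: "B \<subseteq> {..<n}" "card B = d" and C: "C \<subseteq> {..<n}" "card C = d"
    and R: "finite R" "R \<subseteq> A"
  shows "real (card (latin_rectangles n (forbid A B C) R)) \<le>
     exp (\<Sum>m<card R. real (n - d) * log_fact_mean (n - m) + real d * log_fact_mean (n - d - m))"
  using R
proof (induction R)
  case (insert r R)
  let ?W = "forbid A B C"
  let ?b = "real (n - d) * log_fact_mean (n - card R) + real d * log_fact_mean (n - d - card R)"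
  have "(\<Sum>j<n. log_fact_mean (card ((?W r j - (\<lambda>i. g i j) ` R) \<inter> {..<n}))) = ?b"
    if g: "g \<in> latin_rectangles n ?W R" for g
  proof -
    note used = card_used_symbols[OF g]
    have "card ((?W r j - (\<lambda>i. g i j) ` R) \<inter> {..<n}) = n - d - card R" if j: "j \<in> B" for j
    proof -
      have jn: "j < n" using j B by auto
      have "g i j \<notin> C" if "i \<in> R" for i
      proof -
        have "g i j \<in> ?W i j" using g that jn by (auto simp: latin_rectangles_def matchings_def)
        then show ?thesis using that insert.prems j by (auto simp: forbid_def split: if_splits)
      qed
      then have sub: "(\<lambda>i. g i j) ` R \<subseteq> {..<n} - C" using used(2)[OF jn] by auto
      have "?W r j = - C" using insert.prems j by (simp add: forbid_def)
      then have "(?W r j - (\<lambda>i. g i j) ` R) \<inter> {..<n} = ({..<n} - C) - (\<lambda>i. g i j) ` R" by auto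
      moreover have "card \<dots> = card ({..<n} - C) - card R"
        using sub insert.hyps(1) used(1)[OF jn] by (subst card_Diff_subset) auto
      moreover have "card ({..<n} - C) = n - d"
        using C by (subst card_Diff_subset) (auto intro: finite_subset)
      ultimately show ?thesis by simp
    qed
    moreover have "card ((?W r j - (\<lambda>i. g i j) ` R) \<inter> {..<n}) = n - card R" if j: "j \<in> {..<n} - B" for j
    proof -
      have "(?W r j - (\<lambda>i. g i j) ` R) \<inter> {..<n} = {..<n} - (\<lambda>i. g i j) ` R"
        using j by (auto simp: forbid_def)
      then show ?thesis using used[of j] j insert.hyps(1) by (simp add: card_Diff_subset)
    qed
    moreover have "(\<Sum>j<n. h j) = (\<Sum>j\<in>{..<n} - B. h j) + (\<Sum>j\<in>B. h j)" for h :: "nat \<Rightarrow> real"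
      using B by (intro sum.subset_diff) auto
    moreover have "card ({..<n} - B) = n - d"
      using B by (subst card_Diff_subset) (auto intro: finite_subset)
    ultimately show ?thesis using B by simp
  qed
  then have "real (card (latin_rectangles n ?W (insert r R))) \<le> real (card (latin_rectangles n ?W R)) * exp ?b"
    using insert.hyps by (intro card_latin_rectangles_insert_le)
  also have "\<dots> \<le> exp (\<Sum>m<card R. real (n - d) * log_fact_mean (n - m) + real d * log_fact_mean (n - d - m)) * exp ?b"
    using insert by (intro mult_right_mono) auto
  finally show ?case using insert.hyps by (simp add: exp_add[symmetric])
qed simp

text \<open>Rows outside \<open>A\<close> are unrestricted and have \<open>n - (d + m)\<close> free
  symbols in every column, where \<open>m\<close> counts the rows filled after those of
  \<open>A\<close>.\<close>

lemma card_latin_rectangles_forbid: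
  assumes A: "A \<subseteq> {..<n}" "card A = d" and B: "B \<subseteq> {..<n}" "card B = d" and C: "C \<subseteq> {..<n}" "card C = d"
    and R: "finite R" "R \<inter> A = {}"
  shows "real (card (latin_rectangles n (forbid A B C) (A \<union> R))) \<le>
     exp ((\<Sum>m<d. real (n - d) * log_fact_mean (n - m) + real d * log_fact_mean (n - d - m))
        + (\<Sum>m<card R. real n * log_fact_mean (n - d - m)))"
  using R
proof (induction R)
  case empty
  have "finite A" using A by (auto intro: finite_subset)
  then show ?case using card_latin_rectangles_forbid_inside[OF B C, of A A] A by simp
next
  case (insert r R)
  let ?W = "forbid A B C"
  let ?b = "real n * log_fact_mean (n - d - card R)"
  have finA: "finite A" using A by (auto intro: finite_subset)
  have cardAR: "card (A \<union> R) = d + card R"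
    using insert finA A by (subst card_Un_disjoint) auto
  have "(\<Sum>j<n. log_fact_mean (card ((?W r j - (\<lambda>i. g i j) ` (A \<union> R)) \<inter> {..<n}))) = ?b"
    if g: "g \<in> latin_rectangles n ?W (A \<union> R)" for g
  proof -
    have "card ((?W r j - (\<lambda>i. g i j) ` (A \<union> R)) \<inter> {..<n}) = n - d - card R" if j: "j < n" for j
    proof -
      have "(?W r j - (\<lambda>i. g i j) ` (A \<union> R)) \<inter> {..<n} = {..<n} - (\<lambda>i. g i j) ` (A \<union> R)"
        using insert.prems by (auto simp: forbid_def)
      moreover have "card ({..<n} - (\<lambda>i. g i j) ` (A \<union> R)) = n - (d + card R)"
        using card_used_symbols[OF g j] insert.hyps(1) finA cardAR by (subst card_Diff_subset) auto
      ultimately show ?thesis by simp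
    qed
    then show ?thesis by simp
  qed
  then have "real (card (latin_rectangles n ?W (insert r (A \<union> R)))) \<le> real (card (latin_rectangles n ?W (A \<union> R))) * exp ?b"
    using insert finA by (intro card_latin_rectangles_insert_le) auto
  also have "\<dots> \<le> exp ((\<Sum>m<d. real (n - d) * log_fact_mean (n - m) + real d * log_fact_mean (n - d - m))
        + (\<Sum>m<card R. real n * log_fact_mean (n - d - m))) * exp ?b"
    using insert by (intro mult_right_mono) auto
  finally show ?case using insert.hyps by (simp add: exp_add[symmetric] add_ac)
qed

section \<open>Latin squares as full rectangles\<close>

text \<open>This passes between arrays on pairs and families of rows. An injective map of a finite
  set to itself is bijective, so injectivity of a full column already puts each symbol in it
  once.\<close>

lemma card_latin_squares_restricted:
  "card {L \<in> latin_squares n. \<forall>i<n. \<forall>j<n. L (i, j) \<in> W i j} = card (latin_rectangles n W {..<n})"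
proof -
  define U :: "(nat \<Rightarrow> nat \<Rightarrow> nat) \<Rightarrow> array" where "U = (\<lambda>g. restrict (\<lambda>(i, j). g i j) ({..<n} \<times> {..<n}))"
  have U: "U g (i, j) = g i j" if "i < n" "j < n" for g i j using that by (simp add: U_def)
  have "bij_betw U (latin_rectangles n W {..<n}) {L \<in> latin_squares n. \<forall>i<n. \<forall>j<n. L (i, j) \<in> W i j}"
  proof (rule bij_betw_imageI)
    show "inj_on U (latin_rectangles n W {..<n})"
    proof (rule inj_onI)
      fix g h assume g: "g \<in> latin_rectangles n W {..<n}" and h: "h \<in> latin_rectangles n W {..<n}" and eq: "U g = U h"
      have "g i j = h i j" if "i < n" for i j
      proof (cases "j < n")
        case True
        then show ?thesis using U that eq by metis
      next
        case False
        then show ?thesis using g h that by (auto simp: latin_rectangles_def matchings_def PiE_iff extensional_def)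
      qed
      moreover have "g i = h i" if "\<not> i < n" for i
        using g h that by (auto simp: latin_rectangles_def PiE_def extensional_def)
      ultimately show "g = h" by (auto simp: fun_eq_iff)
    qed
    show "U ` latin_rectangles n W {..<n} = {L \<in> latin_squares n. \<forall>i<n. \<forall>j<n. L (i, j) \<in> W i j}"
    proof (intro equalityI subsetI)
      fix L assume "L \<in> U ` latin_rectangles n W {..<n}"
      then obtain g where g: "g \<in> latin_rectangles n W {..<n}" and L: "L = U g" by auto
      have row: "bij_betw (g i) {..<n} {..<n}" "\<And>j. j < n \<Longrightarrow> g i j \<in> W i j" if "i < n" for i
        using g that by (auto simp: latin_rectangles_def matchings_def PiE_iff)
      have col: "bij_betw (\<lambda>i. g i j) {..<n} {..<n}" if "j < n" for j
      proof -
        have "inj_on (\<lambda>i. g i j) {..<n}" using g that by (simp add: latin_rectangles_def)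
        moreover have "(\<lambda>i. g i j) ` {..<n} \<subseteq> {..<n}" by (rule card_used_symbols(2)[OF g that])
        ultimately show ?thesis by (simp add: bij_betw_def endo_inj_surj)
      qed
      have "L \<in> {..<n} \<times> {..<n} \<rightarrow>\<^sub>E {..<n}"
        using row(1) unfolding L U_def by (auto dest: bij_betwE)
      moreover have "\<exists>!j. j < n \<and> L (i, j) = k" if "i < n" "k < n" for i k
      proof -
        have "\<exists>!j. j \<in> {..<n} \<and> g i j = k" using bij_betw_iff_bijections row(1)[OF that(1)] that(2)
          by (auto simp: bij_betw_def inj_on_def) (metis imageE lessThan_iff)
        then show ?thesis using U that by (simp add: L cong: conj_cong)
      qed
      moreover have "\<exists>!i. i < n \<and> L (i, j) = k" if "j < n" "k < n" for j k
      proof -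
        have "\<exists>!i. i \<in> {..<n} \<and> g i j = k" using col[OF that(1)] that(2)
          by (auto simp: bij_betw_def inj_on_def) (metis imageE lessThan_iff)
        then show ?thesis using U that by (simp add: L cong: conj_cong)
      qed
      ultimately show "L \<in> {L \<in> latin_squares n. \<forall>i<n. \<forall>j<n. L (i, j) \<in> W i j}"
        using row(2) U by (simp add: latin_squares_def L)
    next
      fix L assume L: "L \<in> {L \<in> latin_squares n. \<forall>i<n. \<forall>j<n. L (i, j) \<in> W i j}"
      define g where "g = (\<lambda>i\<in>{..<n}. \<lambda>j\<in>{..<n}. L (i, j))"
      have gL: "g i j = L (i, j)" if "i < n" "j < n" for i j using that by (simp add: g_def)
      have Lfun: "L \<in> {..<n} \<times> {..<n} \<rightarrow>\<^sub>E {..<n}" and W: "\<And>i j. i < n \<Longrightarrow> j < n \<Longrightarrow> L (i, j) \<in> W i j"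
        and row: "\<And>i k. i < n \<Longrightarrow> k < n \<Longrightarrow> \<exists>!j. j < n \<and> L (i, j) = k"
        and col: "\<And>j k. j < n \<Longrightarrow> k < n \<Longrightarrow> \<exists>!i. i < n \<and> L (i, j) = k"
        using L by (auto simp: latin_squares_def)
      have Lless: "L (i, j) < n" if "i < n" "j < n" for i j using Lfun that by auto
      have "g i \<in> matchings {..<n} {..<n} (W i)" if i: "i < n" for i
      proof -
        have "inj_on (g i) {..<n}" using row[OF i] Lless[OF i] gL[OF i]
          unfolding inj_on_def by (metis lessThan_iff)
        moreover have "g i ` {..<n} \<subseteq> {..<n}" using Lless[OF i] gL[OF i] by auto
        ultimately have "bij_betw (g i) {..<n} {..<n}" by (simp add: bij_betw_def endo_inj_surj)
        then show ?thesis using W[OF i] gL[OF i] Lless[OF i] i by (auto simp: matchings_def g_def)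
      qed
      moreover have "inj_on (\<lambda>i. g i j) {..<n}" if j: "j < n" for j
        using col[OF j] Lless[OF _ j] gL[OF _ j] unfolding inj_on_def by (metis lessThan_iff)
      ultimately have "g \<in> latin_rectangles n W {..<n}"
        by (auto simp: latin_rectangles_def g_def)
      moreover have "L = U g"
      proof
        fix x show "L x = U g x"
        proof (cases "x \<in> {..<n} \<times> {..<n}")
          case True
          then show ?thesis using U gL by (cases x) auto
        next
          case False
          then show ?thesis using PiE_arb[OF Lfun False] by (simp add: U_def)
        qed
      qed
      ultimately show "L \<in> U ` latin_rectangles n W {..<n}" by blast
    qed
  qed
  then show ?thesis by (rule bij_betw_same_card[symmetric])
qed

section \<open>Estimates for factorials\<close>

lemma ln_fact_Suc: "ln (fact (Suc k) :: real) = ln (real (Suc k)) + ln (fact k)"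
  unfolding fact_Suc by (simp add: ln_mult_pos del: of_nat_Suc)

lemma sum_ln_Suc: "(\<Sum>k<n. ln (real (Suc k))) = ln (fact n)"
  by (induction n) (simp_all add: ln_fact_Suc del: of_nat_Suc fact_Suc)

text \<open>The numbers from 1 to \<open>k\<close> have mean \<open>(k + 1) / 2\<close>; the
  induction replaces the comparison of means by Bernoulli's inequality. The 2 becomes the constant
  \<open>ln 2\<close> of the saving.\<close>

lemma fact_le_half_power: "fact k \<le> (real (Suc k) / 2) ^ k"
proof (induction k)
  case (Suc k)
  have "1 + real (Suc k) * (1 / real (Suc k)) \<le> (1 + 1 / real (Suc k)) ^ Suc k"
    by (rule Bernoulli_inequality) (simp add: field_simps)
  then have "2 \<le> (real (Suc (Suc k)) / real (Suc k)) ^ Suc k"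
    by (simp add: field_simps)
  then have "real (Suc k) * (real (Suc k) / 2) ^ k * 2 \<le> real (Suc k) * (real (Suc k) / 2) ^ k * (real (Suc (Suc k)) / real (Suc k)) ^ Suc k"
    by (intro mult_left_mono) auto
  also have "\<dots> = 2 * ((real (Suc k) / 2) ^ Suc k * (real (Suc (Suc k)) / real (Suc k)) ^ Suc k)"
    unfolding power_Suc[of "real (Suc k) / 2"] by (simp del: of_nat_Suc power_Suc)
  also have "\<dots> = 2 * ((real (Suc k) / 2) * (real (Suc (Suc k)) / real (Suc k))) ^ Suc k"
    by (simp only: power_mult_distrib)
  also have "(real (Suc k) / 2) * (real (Suc (Suc k)) / real (Suc k)) = real (Suc (Suc k)) / 2"
    by (simp del: of_nat_Suc)
  finally have "real (Suc k) * (real (Suc k) / 2) ^ k \<le> (real (Suc (Suc k)) / 2) ^ Suc k" by simp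
  moreover have "fact (Suc k) \<le> real (Suc k) * (real (Suc k) / 2) ^ k"
    unfolding fact_Suc using Suc by (intro mult_left_mono) auto
  ultimately show ?case by linarith
qed simp

text \<open>Over the denominator \<open>k * (k + 1)\<close> the numerator is
  \<open>k * ln (k + 1) - ln (fact k)\<close>, which is at least \<open>k * ln 2\<close>. At
  \<open>k = 0\<close> both means are \<open>0\<close>, hence the hypothesis.\<close>

lemma log_fact_mean_Suc_ge:
  assumes "k \<ge> 1"
  shows "log_fact_mean (Suc k) - log_fact_mean k \<ge> ln 2 / real (Suc k)"
proof -
  have "ln (fact k) \<le> ln ((real (Suc k) / 2) ^ k)"
    using fact_le_half_power[of k] by (subst ln_le_cancel_iff) auto
  also have "\<dots> = real k * (ln (real (Suc k)) - ln 2)"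
    by (simp add: ln_realpow ln_divide_pos del: of_nat_Suc)
  finally have "ln (fact k) \<le> real k * (ln (real (Suc k)) - ln 2)" .
  then have "real k * ln (fact (Suc k)) - real (Suc k) * ln (fact k) \<ge> real k * ln 2"
    unfolding ln_fact_Suc by (simp add: algebra_simps)
  moreover have "log_fact_mean (Suc k) - log_fact_mean k
      = (real k * ln (fact (Suc k)) - real (Suc k) * ln (fact k)) / (real k * real (Suc k))"
    using assms unfolding log_fact_mean_def by (simp add: diff_frac_eq mult.commute del: of_nat_Suc fact_Suc)
  ultimately have "log_fact_mean (Suc k) - log_fact_mean k \<ge> real k * ln 2 / (real k * real (Suc k))"
    by (simp only:) (rule divide_right_mono, simp_all del: fact_Suc of_nat_Suc)
  then show ?thesis using assms by simp
qed

text \<open>Each of the \<open>d\<close> increments is at least \<open>ln 2 / n\<close>, since no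
  argument exceeds \<open>n\<close>.\<close>

lemma log_fact_mean_diff_ge:
  assumes "a \<ge> 1" "a + d \<le> n"
  shows "log_fact_mean (a + d) - log_fact_mean a \<ge> real d * ln 2 / real n"
  using assms
proof (induction d)
  case (Suc d)
  have "ln 2 / real n \<le> ln 2 / real (Suc (a + d))"
    using Suc.prems by (intro divide_left_mono) auto
  also have "\<dots> \<le> log_fact_mean (Suc (a + d)) - log_fact_mean (a + d)"
    using Suc.prems by (intro log_fact_mean_Suc_ge) auto
  finally show ?case using Suc by (simp add: algebra_simps add_divide_distrib)
qed simp

lemma ln_Suc_diff_bounds:
  assumes "k \<ge> 1"
  shows "1 / real (Suc k) \<le> ln (real (Suc k)) - ln (real k)" "ln (real (Suc k)) - ln (real k) \<le> 1 / real k"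
proof -
  have "ln (real k / real (Suc k)) \<le> real k / real (Suc k) - 1"
    using assms by (intro ln_le_minus_one) auto
  moreover have "real k / real (Suc k) - 1 = - (1 / real (Suc k))" by (simp add: field_simps)
  moreover have "ln (real k / real (Suc k)) = ln (real k) - ln (real (Suc k))"
    using assms by (intro ln_divide_pos) auto
  ultimately show "1 / real (Suc k) \<le> ln (real (Suc k)) - ln (real k)" by linarith
  have "ln (real (Suc k) / real k) \<le> real (Suc k) / real k - 1"
    using assms by (intro ln_le_minus_one) auto
  moreover have "real (Suc k) / real k - 1 = 1 / real k" using assms by (simp add: field_simps)
  moreover have "ln (real (Suc k) / real k) = ln (real (Suc k)) - ln (real k)"
    using assms by (intro ln_divide_pos) auto
  ultimately show "ln (real (Suc k)) - ln (real k) \<le> 1 / real k" by linarith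
qed

text \<open>Half of a crude Stirling estimate: \<open>(n / e) ^ n\<close> is at most
  \<open>fact n\<close>. The upper half loses a factor \<open>e * n\<close>, the source of the term
  \<open>(1 + ln n) ^ 2\<close> in the later bounds.\<close>

lemma ln_fact_ge: "real n * ln (real n) - real n \<le> ln (fact n)"
proof (induction n)
  case (Suc k)
  show ?case
  proof (cases "k = 0")
    case False
    then have "ln (real (Suc k)) - ln (real k) \<le> 1 / real k" by (intro ln_Suc_diff_bounds) auto
    then have "real k * (ln (real (Suc k)) - ln (real k)) \<le> 1"
      using False by (simp add: field_simps)
    then have "real k * ln (real (Suc k)) - real k * ln (real k) \<le> 1" by (simp only: right_diff_distrib)
    moreover have "real (Suc k) * ln (real (Suc k)) = real k * ln (real (Suc k)) + ln (real (Suc k))"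
      by (simp add: algebra_simps)
    ultimately show ?thesis using Suc unfolding ln_fact_Suc by (simp del: of_nat_Suc)
  qed simp
qed simp

lemma ln_fact_le:
  assumes "n \<ge> 1"
  shows "ln (fact n) \<le> 1 + ln (real n) + real n * ln (real n) - real n"
  using assms
proof (induction n rule: nat_induct_at_least)
  case (Suc k)
  have "1 / real (Suc k) \<le> ln (real (Suc k)) - ln (real k)" using Suc by (intro ln_Suc_diff_bounds) auto
  then have "1 \<le> real (Suc k) * (ln (real (Suc k)) - ln (real k))"
    by (simp add: field_simps)
  then have "1 \<le> real (Suc k) * ln (real (Suc k)) - real (Suc k) * ln (real k)" by (simp only: right_diff_distrib)
  moreover have "real (Suc k) * ln (real k) = real k * ln (real k) + ln (real k)"
    by (simp add: algebra_simps)
  ultimately show ?case using Suc unfolding ln_fact_Suc by (simp del: of_nat_Suc)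
qed simp

text \<open>Stirling gives \<open>ln (k + 1) - 1\<close> for each mean, up to an error of at most
  \<open>(1 + ln n) / (k + 1)\<close>; the harmonic sum turns the errors into a square.\<close>

lemma sum_log_fact_mean_le:
  assumes "n \<ge> 1"
  shows "(\<Sum>k<n. log_fact_mean (Suc k)) \<le> ln (fact n) - real n + (1 + ln (real n))\<^sup>2"
proof -
  have le: "log_fact_mean (Suc k) \<le> ln (real (Suc k)) - 1 + (1 + ln (real n)) * (1 / real (Suc k))" if "k < n" for k
  proof -
    have "log_fact_mean (Suc k) \<le> (1 + ln (real (Suc k)) + real (Suc k) * ln (real (Suc k)) - real (Suc k)) / real (Suc k)"
      unfolding log_fact_mean_def by (intro divide_right_mono ln_fact_le) auto
    also have "\<dots> = ln (real (Suc k)) - 1 + (1 + ln (real (Suc k))) * (1 / real (Suc k))"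
      by (simp add: add_divide_distrib diff_divide_distrib del: of_nat_Suc)
    also have "\<dots> \<le> ln (real (Suc k)) - 1 + (1 + ln (real n)) * (1 / real (Suc k))"
      using that by (intro add_left_mono mult_right_mono) auto
    finally show ?thesis .
  qed
  have harm: "(\<Sum>k<n. 1 / real (Suc k)) \<le> 1 + ln (real n)"
    using assms
  proof (induction n rule: nat_induct_at_least)
    case (Suc m)
    then show ?case using ln_Suc_diff_bounds(1)[of m] by (simp del: of_nat_Suc)
  qed simp
  have "(\<Sum>k<n. log_fact_mean (Suc k)) \<le> (\<Sum>k<n. ln (real (Suc k)) - 1 + (1 + ln (real n)) * (1 / real (Suc k)))"
    by (intro sum_mono le) auto
  also have "\<dots> = ln (fact n) - real n + (1 + ln (real n)) * (\<Sum>k<n. 1 / real (Suc k))"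
    by (simp add: sum.distrib sum_subtractf sum_ln_Suc sum_distrib_left del: of_nat_Suc)
  also have "\<dots> \<le> ln (fact n) - real n + (1 + ln (real n)) * (1 + ln (real n))"
    using assms by (intro add_left_mono mult_left_mono harm) auto
  finally show ?thesis by (simp add: power2_eq_square)
qed

section \<open>Counting Latin squares\<close>

text \<open>The row-by-row bounds multiply to \<open>fact n ^ (2 * n) / n ^ (n ^ 2)\<close>.\<close>

lemma card_latin_squares_ge:
  assumes "n \<ge> 1"
  shows "exp (2 * real n * ln (fact n) - (real n)\<^sup>2 * ln (real n)) \<le> real (card (latin_squares n))"
proof -
  have "fact n * (real (n - k) / real n) ^ n = exp (ln (fact n) + real n * (ln (real (n - k)) - ln (real n)))"
    if "k < n" for k
    using that by (simp add: exp_add exp_diff exp_of_nat_mult power_divide right_diff_distrib)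
  then have "(\<Prod>k<n. fact n * (real (n - k) / real n) ^ n)
      = exp (\<Sum>k<n. ln (fact n) + real n * (ln (real (n - k)) - ln (real n)))"
    by (simp add: exp_sum)
  also have "(\<Sum>k<n. ln (fact n) + real n * (ln (real (n - k)) - ln (real n)))
      = real n * ln (fact n) + real n * (\<Sum>k<n. ln (real (n - k))) - (real n)\<^sup>2 * ln (real n)"
    by (simp add: sum.distrib sum_subtractf sum_distrib_left[symmetric] right_diff_distrib power2_eq_square)
  also have "(\<Sum>k<n. ln (real (n - k))) = ln (fact n)"
  proof -
    have "(\<Sum>k<n. ln (real (n - k))) = (\<Sum>k<n. ln (real (Suc (n - Suc k))))"
      by (intro sum.cong) (auto simp: Suc_diff_Suc)
    also have "\<dots> = (\<Sum>k<n. ln (real (Suc k)))" by (rule sum.nat_diff_reindex)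
    also have "\<dots> = ln (fact n)" by (rule sum_ln_Suc)
    finally show ?thesis .
  qed
  finally show ?thesis
    using card_latin_rectangles_ge[of n n] card_latin_squares_restricted[of n "\<lambda>_ _. UNIV"] by (simp add: mult.assoc)
qed

lemma card_latin_squares_forbid_le:
  assumes "n \<ge> 1" "2 * d \<le> n"
    and A: "A \<subseteq> {..<n}" "card A = d" and B: "B \<subseteq> {..<n}" "card B = d" and C: "C \<subseteq> {..<n}" "card C = d"
  shows "real (card {L \<in> latin_squares n. \<forall>i<n. \<forall>j<n. L (i, j) \<in> forbid A B C i j})
     \<le> real (card (latin_squares n)) * exp (real n * (1 + ln (real n))\<^sup>2 - ln 2 * real d ^ 3 / real n)"
proof -
  let ?f = log_fact_mean
  have finA: "finite A" using A by (auto intro: finite_subset)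
  have cardc: "card ({..<n} - A) = n - d" using A finA by (simp add: card_Diff_subset)
  have AU: "A \<union> ({..<n} - A) = {..<n}" using A by auto
  \<comment> \<open>In the first \<open>d\<close> rows, \<open>d\<close> columns have
    \<open>?f (n - d - m)\<close> in place of \<open>?f (n - m)\<close>; everything else is the
    Bregman sum of the unrestricted count.\<close>
  have "(\<Sum>m<d. real (n - d) * ?f (n - m) + real d * ?f (n - d - m)) + (\<Sum>m<n - d. real n * ?f (n - d - m))
      = real n * (\<Sum>m<n. ?f (n - m)) - real d * (\<Sum>m<d. ?f (n - m) - ?f (n - d - m))"
  proof -
    have "(\<Sum>m<d + q. h m) = (\<Sum>m<d. h m) + (\<Sum>m<q. h (d + m))" for h :: "nat \<Rightarrow> real" and q
      by (induction q) auto
    from this[of "\<lambda>m. ?f (n - m)" "n - d"]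
    have split: "(\<Sum>m<n. ?f (n - m)) = (\<Sum>m<d. ?f (n - m)) + (\<Sum>m<n - d. ?f (n - d - m))"
      using assms(2) by simp
    have nd: "real (n - d) = real n - real d" using assms(2) by simp
    show ?thesis unfolding split nd
      by (simp add: sum.distrib sum_subtractf sum_distrib_left[symmetric] algebra_simps)
  qed
  also have "\<dots> \<le> real n * (ln (fact n) - real n + (1 + ln (real n))\<^sup>2) - real d * (real d * (real d * ln 2 / real n))"
  proof (intro diff_mono mult_left_mono)
    have "(\<Sum>m<n. ?f (n - m)) = (\<Sum>m<n. ?f (Suc (n - Suc m)))"
      by (intro sum.cong) (auto simp: Suc_diff_Suc)
    also have "\<dots> = (\<Sum>m<n. ?f (Suc m))" by (rule sum.nat_diff_reindex)
    finally show "(\<Sum>m<n. ?f (n - m)) \<le> ln (fact n) - real n + (1 + ln (real n))\<^sup>2"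
      using sum_log_fact_mean_le[OF assms(1)] by simp
    \<comment> \<open>From \<open>m < d\<close> and \<open>2 * d <= n\<close> it follows that
      \<open>n - d - m\<close> is positive, as the increment bound demands.\<close>
    have "real d * ln 2 / real n \<le> ?f (n - m) - ?f (n - d - m)" if "m < d" for m
      using log_fact_mean_diff_ge[of "n - d - m" d n] that assms(2) by simp
    then have "(\<Sum>m<d. real d * ln 2 / real n) \<le> (\<Sum>m<d. ?f (n - m) - ?f (n - d - m))"
      by (intro sum_mono) auto
    then show "real d * (real d * ln 2 / real n) \<le> (\<Sum>m<d. ?f (n - m) - ?f (n - d - m))" by simp
  qed auto
  also have "\<dots> \<le> (2 * real n * ln (fact n) - (real n)\<^sup>2 * ln (real n)) + (real n * (1 + ln (real n))\<^sup>2 - ln 2 * real d ^ 3 / real n)"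
  proof -
    \<comment> \<open>Here the upper bound meets the lower one:
      \<open>n * ln (fact n) - n ^ 2\<close> is at most
      \<open>2 * n * ln (fact n) - n ^ 2 * ln n\<close>.\<close>
    have "real n * (real n * ln (real n) - real n) \<le> real n * ln (fact n)"
      by (intro mult_left_mono ln_fact_ge) auto
    then show ?thesis by (simp add: algebra_simps power2_eq_square power3_eq_cube)
  qed
  finally have le: "(\<Sum>m<d. real (n - d) * ?f (n - m) + real d * ?f (n - d - m)) + (\<Sum>m<n - d. real n * ?f (n - d - m))
    \<le> (2 * real n * ln (fact n) - (real n)\<^sup>2 * ln (real n)) + (real n * (1 + ln (real n))\<^sup>2 - ln 2 * real d ^ 3 / real n)" .
  have "real (card {L \<in> latin_squares n. \<forall>i<n. \<forall>j<n. L (i, j) \<in> forbid A B C i j})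
     \<le> exp ((\<Sum>m<d. real (n - d) * ?f (n - m) + real d * ?f (n - d - m)) + (\<Sum>m<n - d. real n * ?f (n - d - m)))"
  proof -
    have "finite ({..<n} - A)" "({..<n} - A) \<inter> A = {}" by auto
    from card_latin_rectangles_forbid[OF A B C this] show ?thesis
      unfolding card_latin_squares_restricted AU cardc .
  qed
  also have "\<dots> \<le> exp (2 * real n * ln (fact n) - (real n)\<^sup>2 * ln (real n)) * exp (real n * (1 + ln (real n))\<^sup>2 - ln 2 * real d ^ 3 / real n)"
    using le by (simp add: exp_add[symmetric])
  also have "\<dots> \<le> real (card (latin_squares n)) * exp (real n * (1 + ln (real n))\<^sup>2 - ln 2 * real d ^ 3 / real n)"
    by (intro mult_right_mono card_latin_squares_ge assms(1)) auto
  finally show ?thesis .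
qed

section \<open>Maximal partial transversals\<close>

lemma maximal_partial_transversal_forbid:
  assumes L: "L \<in> latin_squares n" and T: "maximal_partial_transversal n L T"
    and D: "has_deficit n T D" "d \<le> D"
  shows "\<exists>A B C. A \<subseteq> {..<n} \<and> card A = d \<and> B \<subseteq> {..<n} \<and> card B = d \<and> C \<subseteq> {..<n} \<and> card C = d \<and>
    (\<forall>i<n. \<forall>j<n. L (i, j) \<in> forbid A B C i j)"
proof -
  have Lless: "L (i, j) < n" if "i < n" "j < n" for i j
    using L that by (auto simp: latin_squares_def)
  have pt: "partial_transversal n L T" and max: "\<And>T'. partial_transversal n L T' \<Longrightarrow> \<not> T \<subset> T'"
    using T by (auto simp: maximal_partial_transversal_def)
  have sub: "T \<subseteq> entries n L" using pt by (simp add: partial_transversal_def)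
  have "finite (entries n L)"
    by (rule finite_subset[of _ "(\<lambda>(i, j). (i, j, L (i, j))) ` ({..<n} \<times> {..<n})"]) (auto simp: entries_def)
  then have finT: "finite T" using sub finite_subset by blast
  \<comment> \<open>A projection of \<open>T\<close> has at most \<open>card T = n - D\<close>
    values and leaves at least \<open>D\<close> indices free; exactly \<open>d\<close> are taken, so
    that the count depends on one parameter.\<close>
  have unused: "\<exists>X. X \<subseteq> {..<n} - p ` T \<and> card X = d" for p :: "entry \<Rightarrow> nat"
  proof -
    have "card {..<n} - card (p ` T) \<le> card ({..<n} - p ` T)"
      using finT by (intro diff_card_le_card_Diff) auto
    moreover have "card (p ` T) \<le> card T" using finT by (rule card_image_le)
    ultimately have "d \<le> card ({..<n} - p ` T)" using D by (simp add: has_deficit_def)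
    then show ?thesis using obtain_subset_with_card_n by metis
  qed
  obtain A where A: "A \<subseteq> {..<n} - fst ` T" "card A = d" using unused by blast
  obtain B where B: "B \<subseteq> {..<n} - (fst \<circ> snd) ` T" "card B = d" using unused by blast
  obtain C where C: "C \<subseteq> {..<n} - (snd \<circ> snd) ` T" "card C = d" using unused by blast
  have "L (i, j) \<notin> C" if ij: "i \<in> A" "j \<in> B" for i j
  proof
    assume c: "L (i, j) \<in> C"
    have ijn: "i < n" "j < n" using A B ij by auto
    let ?e = "(i, j, L (i, j))"
    have new: "fst t \<noteq> i" "fst (snd t) \<noteq> j" "snd (snd t) \<noteq> L (i, j)" if "t \<in> T" for t
      using A(1) B(1) C(1) ij c imageI[OF that, of fst] imageI[OF that, of "fst \<circ> snd"]
        imageI[OF that, of "snd \<circ> snd"] by (metis DiffD2 comp_apply subsetD)+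
    have "?e \<notin> T" using new(1) by force
    have "card (insert ?e T \<inter> l) \<le> 1" if l: "l \<in> lines n L" for l
    proof (cases "?e \<in> l")
      case True
      \<comment> \<open>A line through \<open>?e\<close> fixes one coordinate, in which every entry
        of \<open>T\<close> differs from \<open>?e\<close>.\<close>
      have "T \<inter> l = {}"
      proof (rule equals0I)
        fix t assume "t \<in> T \<inter> l"
        then show False using l True new[of t]
          by (auto simp: lines_def row_line_def column_line_def symbol_line_def)
      qed
      then have "insert ?e T \<inter> l \<subseteq> {?e}" by auto
      then show ?thesis using card_mono[of "{?e}"] by fastforce
    next
      case False
      then show ?thesis using pt l by (auto simp: partial_transversal_def)
    qed
    then have "partial_transversal n L (insert ?e T)"
      using sub ijn by (auto simp: partial_transversal_def entries_def)
    then show False using max \<open>?e \<notin> T\<close> by blast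
  qed
  then have "\<forall>i<n. \<forall>j<n. L (i, j) \<in> forbid A B C i j" by (auto simp: forbid_def)
  then show ?thesis using A B C by blast
qed

theorem prob_large_deficit_le:
  assumes "n \<ge> 1" "2 * d \<le> n"
  shows "measure_pmf.prob (random_latin_square n)
     {L. \<exists>T D. maximal_partial_transversal n L T \<and> has_deficit n T D \<and> d \<le> D}
     \<le> 8 ^ n * exp (real n * (1 + ln (real n))\<^sup>2 - ln 2 * real d ^ 3 / real n)"
proof -
  let ?bad = "{L. \<exists>T D. maximal_partial_transversal n L T \<and> has_deficit n T D \<and> d \<le> D}"
  let ?F = "\<lambda>(A, B, C). {L \<in> latin_squares n. \<forall>i<n. \<forall>j<n. L (i, j) \<in> forbid A B C i j}"
  let ?S = "{X. X \<subseteq> {..<n} \<and> card X = d}"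
  let ?P = "?S \<times> ?S \<times> ?S"
  let ?x = "exp (real n * (1 + ln (real n))\<^sup>2 - ln 2 * real d ^ 3 / real n)"
  have N: "card (latin_squares n) > 0"
    using finite_latin_squares latin_squares_nonempty by (simp add: card_gt_0_iff)
  have S: "finite ?S" "card ?S \<le> 2 ^ n"
  proof -
    have sub: "?S \<subseteq> Pow {..<n}" by auto
    then show "finite ?S" by (rule finite_subset) simp
    from card_mono[OF _ sub] show "card ?S \<le> 2 ^ n" by (simp add: card_Pow)
  qed
  \<comment> \<open>The event ranges over all arrays, so it is first cut down to the support of the
    distribution.\<close>
  have "latin_squares n \<inter> ?bad \<subseteq> (\<Union>p\<in>?P. ?F p)"
  proof
    fix L assume "L \<in> latin_squares n \<inter> ?bad"
    then obtain T D where L: "L \<in> latin_squares n"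
      and T: "maximal_partial_transversal n L T" "has_deficit n T D" "d \<le> D" by auto
    obtain A B C where "A \<in> ?S" "B \<in> ?S" "C \<in> ?S" "\<forall>i<n. \<forall>j<n. L (i, j) \<in> forbid A B C i j"
      using maximal_partial_transversal_forbid[OF L T] by auto
    with L show "L \<in> (\<Union>p\<in>?P. ?F p)" by (intro UN_I[of "(A, B, C)"]) simp_all
  qed
  moreover have "finite (\<Union>p\<in>?P. ?F p)" using S(1) finite_latin_squares[of n] by auto
  ultimately have "card (latin_squares n \<inter> ?bad) \<le> card (\<Union>p\<in>?P. ?F p)" by (rule card_mono[rotated])
  also have "\<dots> \<le> (\<Sum>p\<in>?P. card (?F p))" using S(1) by (intro card_UN_le finite_cartesian_product)
  finally have "real (card (latin_squares n \<inter> ?bad)) \<le> real (\<Sum>p\<in>?P. card (?F p))"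
    by (rule of_nat_mono)
  also have "\<dots> = (\<Sum>p\<in>?P. real (card (?F p)))" by (rule of_nat_sum)
  also have "\<dots> \<le> (\<Sum>p\<in>?P. real (card (latin_squares n)) * ?x)"
  proof (rule sum_mono)
    fix p assume "p \<in> ?P"
    then obtain A B C where p: "p = (A, B, C)" "A \<in> ?S" "B \<in> ?S" "C \<in> ?S" by auto
    then show "real (card (?F p)) \<le> real (card (latin_squares n)) * ?x"
      using card_latin_squares_forbid_le[OF assms, of A B C] by simp
  qed
  also have "\<dots> = real (card ?S) * real (card ?S) * real (card ?S) * (real (card (latin_squares n)) * ?x)"
    by (simp add: card_cartesian_product)
  also have "\<dots> \<le> 2 ^ n * 2 ^ n * 2 ^ n * (real (card (latin_squares n)) * ?x)"
  proof -
    have "real (card ?S) \<le> 2 ^ n" using of_nat_mono[OF S(2), where 'a = real] by simp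
    then show ?thesis by (intro mult_right_mono mult_mono) auto
  qed
  also have "(2 ^ n * 2 ^ n * 2 ^ n :: real) = 8 ^ n" by (simp add: power_mult_distrib[symmetric])
  finally have "real (card (latin_squares n \<inter> ?bad)) / real (card (latin_squares n)) \<le> 8 ^ n * ?x"
    using N by (simp add: pos_divide_le_eq mult_ac)
  then show ?thesis
    unfolding random_latin_square_def
    by (simp add: measure_pmf_of_set[OF latin_squares_nonempty finite_latin_squares])
qed

section \<open>Asymptotics of the union bound\<close>

theorem theorem3p10:
  fixes \<epsilon> :: real
  assumes "\<epsilon> > 0"
  shows "(\<lambda>n. measure_pmf.prob (random_latin_square n)
           {L. \<not> (\<exists>T d. maximal_partial_transversal n L T \<and> has_deficit n T d \<and>
                      real d > real n powr (2/3 + \<epsilon>))})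
         \<longlonglongrightarrow> 1"
proof -
  \<comment> \<open>The cap \<open>1/6\<close> keeps \<open>2/3 + \<delta>\<close> at most
    \<open>5/6\<close>, so that \<open>2 * d <= n\<close> for large \<open>n\<close>; lowering the
    exponent only enlarges the bad event.\<close>
  define \<delta> where "\<delta> = min \<epsilon> (1/6)"
  have \<delta>: "0 < \<delta>" "\<delta> \<le> \<epsilon>" "\<delta> \<le> 1/6" using assms by (auto simp: \<delta>_def)
  \<comment> \<open>The exponent collects the union bound \<open>8 ^ n\<close>, the gap between the
    two counts and the saving. As \<open>(n powr (2/3 + \<delta>)) ^ 3 / n = n powr (1 + 3 *
    \<delta>)\<close>, the saving dominates.\<close>
  define u :: "nat \<Rightarrow> real" where
    "u = (\<lambda>n. exp (real n * ln 8 + real n * (1 + ln (real n))\<^sup>2 - ln 2 * real n powr (1 + 3 * \<delta>)))"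
  have u: "u \<longlonglongrightarrow> 0" unfolding u_def using \<delta>(1) by real_asymp
  have small: "eventually (\<lambda>n. 2 * (real n powr (5/6) + 1) \<le> real n) sequentially" by real_asymp
  have lower: "eventually (\<lambda>n. 1 - u n \<le> measure_pmf.prob (random_latin_square n)
      {L. \<not> (\<exists>T d. maximal_partial_transversal n L T \<and> has_deficit n T d \<and> real d > real n powr (2/3 + \<epsilon>))}) sequentially"
    using small eventually_ge_at_top[of 1]
  proof eventually_elim
    case (elim n)
    let ?M = "random_latin_square n"
    let ?big = "{L. \<exists>T d. maximal_partial_transversal n L T \<and> has_deficit n T d \<and> real d > real n powr (2/3 + \<epsilon>)}"
    \<comment> \<open>Rounding up keeps \<open>d ^ 3\<close> large enough, and since deficits are
      integers it still gives \<open>d <= D\<close> for every excessive deficit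
      \<open>D\<close>.\<close>
    define d where "d = nat \<lceil>real n powr (2/3 + \<delta>)\<rceil>"
    have n: "real n \<ge> 1" using elim by simp
    have d_ge: "real n powr (2/3 + \<delta>) \<le> real d" unfolding d_def by linarith
    have "real d \<le> real n powr (2/3 + \<delta>) + 1" unfolding d_def by simp
    also have "real n powr (2/3 + \<delta>) \<le> real n powr (5/6)" using n \<delta> by (intro powr_mono) auto
    finally have "real (2 * d) \<le> real n" using elim by simp
    then have d2: "2 * d \<le> n" by (simp only: of_nat_le_iff)
    have "real n powr (2/3 + \<delta>) \<le> real n powr (2/3 + \<epsilon>)" using n \<delta> by (intro powr_mono) auto
    then have "d \<le> D" if "real n powr (2/3 + \<epsilon>) < real D" for D
      using that unfolding d_def by (simp add: ceiling_le_iff)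
    then have "?big \<subseteq> {L. \<exists>T D. maximal_partial_transversal n L T \<and> has_deficit n T D \<and> d \<le> D}"
      by blast
    then have "measure_pmf.prob ?M ?big \<le> measure_pmf.prob ?M {L. \<exists>T D. maximal_partial_transversal n L T \<and> has_deficit n T D \<and> d \<le> D}"
      by (intro measure_pmf.finite_measure_mono) auto
    also have "\<dots> \<le> 8 ^ n * exp (real n * (1 + ln (real n))\<^sup>2 - ln 2 * real d ^ 3 / real n)"
      by (rule prob_large_deficit_le[OF elim(2) d2])
    also have "\<dots> = exp (real n * ln 8 + (real n * (1 + ln (real n))\<^sup>2 - ln 2 * real d ^ 3 / real n))"
      by (simp add: exp_add exp_of_nat_mult)
    also have "\<dots> \<le> u n"
    proof -
      have "real n powr (2 + 3 * \<delta>) = (real n powr (2/3 + \<delta>)) ^ 3"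
        using n by (simp add: powr_power algebra_simps)
      also have "\<dots> \<le> real d ^ 3" using d_ge by (intro power_mono) auto
      finally have "real n powr (2 + 3 * \<delta>) / real n \<le> real d ^ 3 / real n" by (intro divide_right_mono) auto
      moreover have "real n powr (2 + 3 * \<delta>) / real n = real n powr (1 + 3 * \<delta>)"
        using n powr_diff[of "real n" "2 + 3 * \<delta>" 1] by simp
      ultimately have "ln 2 * real n powr (1 + 3 * \<delta>) \<le> ln 2 * (real d ^ 3 / real n)"
        by (intro mult_left_mono) auto
      then show ?thesis by (simp add: u_def)
    qed
    finally have "measure_pmf.prob ?M ?big \<le> u n" .
    moreover have "measure_pmf.prob ?M (UNIV - ?big) = 1 - measure_pmf.prob ?M ?big"
      using measure_pmf.prob_compl[of ?big ?M] by simp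
    moreover have "UNIV - ?big = {L. \<not> (\<exists>T d. maximal_partial_transversal n L T \<and> has_deficit n T d \<and> real d > real n powr (2/3 + \<epsilon>))}"
      by auto
    ultimately show ?case by simp
  qed
  show ?thesis
  proof (rule tendsto_sandwich[OF lower])
    show "(\<lambda>n. 1 - u n) \<longlonglongrightarrow> 1" using tendsto_diff[OF tendsto_const u, of 1] by simp
    show "(\<lambda>_. 1 :: real) \<longlonglongrightarrow> 1" by simp
  qed (simp add: measure_pmf.prob_le_1)
qed

end
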